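(* Fix a cylindric constraint system and a set $\mathcal{D}$ of process definitions, as described in the context. For every CCP process $P$, every constraint $c$ and every identifier $i \in \mathbb{N}$, the following are equivalent: (1) there exist $X', \Gamma', d'$ such that $(\emptyset; P; \texttt{t}) \longrightarrow^{*} (X'; \Gamma'; d')$ in the standard operational semantics and $\exists X'. d' \models c$; (2) there exist $n \geq 0$ and a sequence of collecting-semantics transitions $(\emptyset; P\!:\!i; \emptyset) = (X_0;\Gamma_0;S_0) \to (X_1;\Gamma_1;S_1) \to \cdots \to (X_n;\Gamma_n;S_n)$ such that $\exists X_n. \bigsqcup_{d \in S_n} d \models c$.
   Context: A cylindric constraint system is a structure $\langle \mathcal{C},\leq,\sqcup,\texttt{t},\texttt{f},\mathit{Var},\exists,D\rangle$ where $\langle \mathcal{C},\leq,\sqcup,\texttt{t},\texttt{f}\rangle$ is a complete algebraic lattice (elements are constraints, $\sqcup$ is conjunction, $\texttt{t}$ least, $\texttt{f}$ greatest), $d \models c$ means $c \leq d$, $c\cong d$ means $c\le d$ and $d\le c$; $\mathit{Var}$ is a denumerable set of variables and each $\exists x:\mathcal{C}\to\mathcal{C}$ satisfies: $\exists x(c)\le c$; $c\le d \Rightarrow \exists x(c)\le\exists x(d)$; $\exists x(c\sqcup\exists x(d))\cong\exists x(c)\sqcup\exists x(d)$; $\exists x\exists y(c)\cong\exists y\exists x(c)$; $\exists x\bigsqcup_i c_i\cong\bigsqcup_i\exists x(c_i)$ for increasing chains. Diagonal elements $d_{xy}\in D$ satisfy $d_{xx}\cong\texttt{t}$; $d_{xy}\cong\exists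 z(d_{xz}\sqcup d_{zy})$ for $z\ne x,y$; $c\le d_{xy}\sqcup\exists x(c\sqcup d_{xy})$ for $x\ne y$. Constraints are built from atomic constraints (tokens) using $\sqcup$ and $\exists$; $\exists x.c$ binds $x$; $fv(c)$, $bv(c)$ denote free/bound variables. For a finite set $X=\{x_1,\dots,x_m\}$, $\exists X.c$ means $\exists x_1\cdots\exists x_m.c$; $\bigsqcup\emptyset=\texttt{t}$. Processes: $P,Q ::= \mathbf{skip} \mid \mathbf{tell}(c) \mid \sum_{i\in I}\mathbf{ask}(c_i)\rightarrow P_i \mid P\parallel Q \mid (\mathbf{local}\,x)\,P \mid p(\overline{x})$, with $I$ finite nonempty. $\mathcal{D}$ contains definitions $p(\overline{y}) \stackrel{\Delta}{=} P$ with $fv(P)\subseteq\overline{y}$, $\overline{y}$ pairwise distinct. Structural congruence $\cong$ on processes: alpha conversion of bound variables, commutativity and associativity of $\parallel$, and $P\parallel\mathbf{skip}\cong P$. Standard semantics: configurations $(X;\Gamma;d)$ with $X$ a set of hidden variables, $\Gamma$ a multiset of processes (representing their parallel composition), $d$ a constraint. Rules (with $\Gamma$ the rest of the multiset): $(X;\mathbf{tell}(c),\Gamma;d)\to(X;\mathbf{skip},\Gamma;c\sqcup d)$; $(X;\sum_{i\in I}\mathbf{ask}(c_i)\rightarrow P_i,\Gamma;d)\to(X;P_k,\Gamma;d)$ if $k\in I$ and $d\models c_k$; $(X;(\mathbf{local}\,x)P,\Gamma;d)\to(X\cup\{x\};P,\Gamma;d)$ if $x\notin X\cup fv(d)\cup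 fv(\Gamma)$; $(X;p(\overline{x}),\Gamma;d)\to(X;P[\overline{x}/\overline{y}],\Gamma;d)$ if $p(\overline{y})\stackrel{\Delta}{=}P\in\mathcal{D}$; and if $(X;\Gamma;c)\cong(X';\Gamma';c')\to(Y';\Delta';d')\cong(Y;\Delta;d)$ then $(X;\Gamma;c)\to(Y;\Delta;d)$. $\to^*$ is the reflexive-transitive closure. Collecting semantics: configurations $(X;\Gamma;S)$ with $X$ a set of hidden variables, $\Gamma$ a finite sequence of processes each tagged with a unique identifier in $\mathbb{N}$ (written $P\!:\!i$), and $S$ a set of atomic constraints (representing $\bigsqcup_{d\in S}d$). A tagged parallel composition $(P_1\parallel\cdots\parallel P_n)\!:\!i$ is identified with the sequence $P_1\!:\!i_1,\dots,P_n\!:\!i_n$ of distinct fresh identifiers. Let $\mathit{fvars}=X\cup fv(S)\cup fv(\Gamma)\cup fv(\Gamma')$, and "$:j$" denotes a fresh identifier. For $V\subseteq\mathit{Var}$, $atoms(c,V)=\langle bv(c),basic(c)\rangle$ where $c$ is first alpha-converted so its bound variables are distinct and not in $V$, and $basic(c)=\{c\}$ if $c$ is an atom, $\texttt{t}$, $\texttt{f}$ or some $d_{xy}$; $basic(\exists x.c')=basic(c')$; $basic(c_1\sqcup c_2)=basic(c_1)\cup basic(c_2)$. Rules: $(X;\Gamma,\mathbf{tell}(c)\!:\!i,\Gamma';S)\to(X\cup Y;\Gamma,\Gamma';S\cup S_c)$ where $\langle Y,S_c\rangle=atoms(c,\mathit{fvars})$; $(X;\Gamma,(\sum_{l\in I}\mathbf{ask}(c_l)\rightarrow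 P_l)\!:\!i,\Gamma';S)\to(X;\Gamma,P_k\!:\!j,\Gamma';S)$ if $k\in I$ and $\bigsqcup_{d\in S}d\models c_k$; $(X;\Gamma,((\mathbf{local}\,x)P)\!:\!i,\Gamma';S)\to(X\cup\{x'\};\Gamma,P[x'/x]\!:\!j,\Gamma';S)$ for $x'\in\mathit{Var}\setminus\mathit{fvars}$; $(X;\Gamma,p(\overline{x})\!:\!i,\Gamma';S)\to(X;\Gamma,P[\overline{x}/\overline{y}]\!:\!j,\Gamma';S)$ if $p(\overline{y})\stackrel{\Delta}{=}P\in\mathcal{D}$. Here $\Gamma,\Gamma'$ are arbitrary (possibly empty) sequences.
   Formalization: Added: ∃x(f)=f; atoms have finitely many free variables, ∃x(a)=a for x not free in a, a[y/x] means ∃x(a⊔d_xy); in the collecting rules for tell and local, the fresh variables also avoid the free variables of the selected process. Without these the equivalence can fail. *)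

theory Defs
  imports Main "HOL-Library.Multiset" "HOL-Library.Countable" "HOL-Library.Infinite_Typeclass"
begin

section \<open>Cylindric constraint systems\<close>

text \<open>The order of the lattice is the information order: \<open>sup\<close> is conjunction, \<open>bot\<close> is the
  constraint t, \<open>top\<close> is the constraint f.  The last three fields describe the tokens
  (atomic constraints): their free variables, simultaneous substitution of variables, and their
  meaning in the lattice.\<close>

record ('v, 'a, 'c) csystem =
  ex :: "'v \<Rightarrow> 'c \<Rightarrow> 'c"
  diag :: "'v \<Rightarrow> 'v \<Rightarrow> 'c"
  tok_fv :: "'a \<Rightarrow> 'v set"
  tok_subst :: "('v \<Rightarrow> 'v) \<Rightarrow> 'a \<Rightarrow> 'a"
  tok_sem :: "'a \<Rightarrow> 'c"

definition compact_element :: "'c::complete_lattice \<Rightarrow> bool" where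
  "compact_element k \<longleftrightarrow>
     (\<forall>A. A \<noteq> {} \<longrightarrow> (\<forall>a\<in>A. \<forall>b\<in>A. \<exists>u\<in>A. a \<le> u \<and> b \<le> u) \<longrightarrow> k \<le> Sup A \<longrightarrow> (\<exists>a\<in>A. k \<le> a))"

locale cylindric_constraint_system =
  fixes CS :: "('v::{countable,infinite}, 'a, 'c::complete_lattice) csystem"
  assumes algebraic: "c = Sup {k. compact_element k \<and> k \<le> c}"
    and ex_le: "ex CS x c \<le> c"
    and ex_mono: "c \<le> d \<Longrightarrow> ex CS x c \<le> ex CS x d"
    and ex_sup_ex: "ex CS x (sup c (ex CS x d)) = sup (ex CS x c) (ex CS x d)"
    and ex_commute: "ex CS x (ex CS y c) = ex CS y (ex CS x c)"
    and ex_chain: "mono C \<Longrightarrow> ex CS x (SUP n::nat. C n) = (SUP n. ex CS x (C n))"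
    and diag_refl: "diag CS x x = bot"
    and diag_trans: "z \<noteq> x \<Longrightarrow> z \<noteq> y \<Longrightarrow> diag CS x y = ex CS z (sup (diag CS x z) (diag CS z y))"
    and diag_subst: "x \<noteq> y \<Longrightarrow> c \<le> sup (diag CS x y) (ex CS x (sup c (diag CS x y)))"

text \<open>Tokens are finitary syntactic objects with variables.  Their syntax is tied to the lattice in
  the usual way: \<open>\<exists>x\<close> has no effect on an atomic constraint in which \<open>x\<close> does not occur free, and
  replacing \<open>x\<close> by \<open>y\<close> in \<open>c\<close> amounts to \<open>\<exists>x (c \<squnion> d\<^sub>x\<^sub>y)\<close>.  For t and the
  diagonal elements both properties follow from the cylindric axioms; for f they need
  \<open>ex_top\<close>, which those axioms do not imply (a countermodel is the lattice of equivalence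
  relations on variables, with \<open>\<exists>x\<close> turning \<open>x\<close> into a singleton class).\<close>

locale constraint_language = cylindric_constraint_system CS
  for CS :: "('v::{countable,infinite}, 'a, 'c::complete_lattice) csystem" +
  assumes finite_tok_fv: "finite (tok_fv CS a)"
    and tok_fv_subst: "tok_fv CS (tok_subst CS \<sigma> a) = \<sigma> ` tok_fv CS a"
    and tok_subst_id: "tok_subst CS id a = a"
    and tok_subst_comp: "tok_subst CS \<tau> (tok_subst CS \<sigma> a) = tok_subst CS (\<tau> \<circ> \<sigma>) a"
    and tok_subst_cong: "(\<forall>x\<in>tok_fv CS a. \<sigma> x = \<tau> x) \<Longrightarrow> tok_subst CS \<sigma> a = tok_subst CS \<tau> a"
    and ex_tok: "x \<notin> tok_fv CS a \<Longrightarrow> ex CS x (tok_sem CS a) = tok_sem CS a"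
    and ex_top: "ex CS x top = top"
    and tok_sem_subst:
      "x \<noteq> y \<Longrightarrow> tok_sem CS (tok_subst CS (id(x := y)) a) = ex CS x (sup (tok_sem CS a) (diag CS x y))"

definition entails :: "'c::complete_lattice \<Rightarrow> 'c \<Rightarrow> bool" where
  "entails d c \<longleftrightarrow> c \<le> d"

text \<open>Only used for finite \<open>X\<close>; the order is immaterial by \<open>ex_commute\<close>.\<close>

definition ex_set :: "('v, 'a, 'c) csystem \<Rightarrow> 'v set \<Rightarrow> 'c \<Rightarrow> 'c" where
  "ex_set CS X c = Finite_Set.fold (ex CS) c X"


section \<open>Constraints\<close>

datatype ('v, 'a) con =
    Tok 'a
  | TT
  | FF
  | Diag 'v 'v
  | Conj "('v, 'a) con" "('v, 'a) con"
  | Exi 'v "('v, 'a) con"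

primrec con_sem :: "('v, 'a, 'c::complete_lattice) csystem \<Rightarrow> ('v, 'a) con \<Rightarrow> 'c" where
  "con_sem CS (Tok a) = tok_sem CS a"
| "con_sem CS TT = bot"
| "con_sem CS FF = top"
| "con_sem CS (Diag x y) = diag CS x y"
| "con_sem CS (Conj c d) = sup (con_sem CS c) (con_sem CS d)"
| "con_sem CS (Exi x c) = ex CS x (con_sem CS c)"

primrec con_fv :: "('v, 'a, 'c) csystem \<Rightarrow> ('v, 'a) con \<Rightarrow> 'v set" where
  "con_fv CS (Tok a) = tok_fv CS a"
| "con_fv CS TT = {}"
| "con_fv CS FF = {}"
| "con_fv CS (Diag x y) = {x, y}"
| "con_fv CS (Conj c d) = con_fv CS c \<union> con_fv CS d"
| "con_fv CS (Exi x c) = con_fv CS c - {x}"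

primrec con_binders :: "('v, 'a) con \<Rightarrow> 'v list" where
  "con_binders (Tok a) = []"
| "con_binders TT = []"
| "con_binders FF = []"
| "con_binders (Diag x y) = []"
| "con_binders (Conj c d) = con_binders c @ con_binders d"
| "con_binders (Exi x c) = x # con_binders c"

definition con_bv :: "('v, 'a) con \<Rightarrow> 'v set" where
  "con_bv c = set (con_binders c)"

primrec basic :: "('v, 'a) con \<Rightarrow> ('v, 'a) con set" where
  "basic (Tok a) = {Tok a}"
| "basic TT = {TT}"
| "basic FF = {FF}"
| "basic (Diag x y) = {Diag x y}"
| "basic (Conj c d) = basic c \<union> basic d"
| "basic (Exi x c) = basic c"

text \<open>Capture-avoiding simultaneous substitution: a binder \<open>x\<close> is renamed exactly when it would
  capture a variable of the image of the free variables in its scope.\<close>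

definition avoid :: "'v set \<Rightarrow> 'v \<Rightarrow> 'v" where
  "avoid V x = (if x \<in> V then (SOME y. y \<notin> V) else x)"

primrec con_subst :: "('v, 'a, 'c) csystem \<Rightarrow> ('v \<Rightarrow> 'v) \<Rightarrow> ('v, 'a) con \<Rightarrow> ('v, 'a) con" where
  "con_subst CS \<sigma> (Tok a) = Tok (tok_subst CS \<sigma> a)"
| "con_subst CS \<sigma> TT = TT"
| "con_subst CS \<sigma> FF = FF"
| "con_subst CS \<sigma> (Diag x y) = Diag (\<sigma> x) (\<sigma> y)"
| "con_subst CS \<sigma> (Conj c d) = Conj (con_subst CS \<sigma> c) (con_subst CS \<sigma> d)"
| "con_subst CS \<sigma> (Exi x c) =
     (let x' = avoid (\<sigma> ` (con_fv CS c - {x})) x in Exi x' (con_subst CS (\<sigma>(x := x')) c))"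

inductive con_alpha :: "('v, 'a, 'c) csystem \<Rightarrow> ('v, 'a) con \<Rightarrow> ('v, 'a) con \<Rightarrow> bool" for CS where
  refl: "con_alpha CS c c"
| sym: "con_alpha CS c d \<Longrightarrow> con_alpha CS d c"
| trans: "con_alpha CS c d \<Longrightarrow> con_alpha CS d e \<Longrightarrow> con_alpha CS c e"
| alpha: "y \<notin> con_fv CS c \<Longrightarrow> con_alpha CS (Exi x c) (Exi y (con_subst CS (id(x := y)) c))"
| conj: "con_alpha CS c c' \<Longrightarrow> con_alpha CS d d' \<Longrightarrow> con_alpha CS (Conj c d) (Conj c' d')"
| exi: "con_alpha CS c c' \<Longrightarrow> con_alpha CS (Exi x c) (Exi x c')"

text \<open>The bound variables chosen by the alpha conversion are arbitrary, hence a set of possible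
  results.  As they become hidden variables of the whole store, they must be distinct from
  each other and from the free variables of \<open>c\<close> as well as outside \<open>V\<close>.\<close>

definition atoms :: "('v, 'a, 'c) csystem \<Rightarrow> ('v, 'a) con \<Rightarrow> 'v set \<Rightarrow> ('v set \<times> ('v, 'a) con set) set" where
  "atoms CS c V = {(con_bv c', basic c') | c'. con_alpha CS c c' \<and> distinct (con_binders c') \<and>
     con_bv c' \<inter> con_fv CS c = {} \<and> con_bv c' \<inter> V = {}}"


section \<open>Processes\<close>

datatype ('v, 'a, 'p) proc =
    Skip
  | Tell "('v, 'a) con"
  | Sum "(('v, 'a) con \<times> ('v, 'a, 'p) proc) list"
  | Par "('v, 'a, 'p) proc" "('v, 'a, 'p) proc"
  | Local 'v "('v, 'a, 'p) proc"
  | Call 'p "'v list"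

fun proc_fv :: "('v, 'a, 'c) csystem \<Rightarrow> ('v, 'a, 'p) proc \<Rightarrow> 'v set" where
  "proc_fv CS Skip = {}"
| "proc_fv CS (Tell c) = con_fv CS c"
| "proc_fv CS (Sum bs) = (\<Union>(c, P)\<in>set bs. con_fv CS c \<union> proc_fv CS P)"
| "proc_fv CS (Par P Q) = proc_fv CS P \<union> proc_fv CS Q"
| "proc_fv CS (Local x P) = proc_fv CS P - {x}"
| "proc_fv CS (Call p xs) = set xs"

fun proc_subst :: "('v, 'a, 'c) csystem \<Rightarrow> ('v \<Rightarrow> 'v) \<Rightarrow> ('v, 'a, 'p) proc \<Rightarrow> ('v, 'a, 'p) proc" where
  "proc_subst CS \<sigma> Skip = Skip"
| "proc_subst CS \<sigma> (Tell c) = Tell (con_subst CS \<sigma> c)"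
| "proc_subst CS \<sigma> (Sum bs) = Sum (map (\<lambda>(c, P). (con_subst CS \<sigma> c, proc_subst CS \<sigma> P)) bs)"
| "proc_subst CS \<sigma> (Par P Q) = Par (proc_subst CS \<sigma> P) (proc_subst CS \<sigma> Q)"
| "proc_subst CS \<sigma> (Local x P) =
     (let x' = avoid (\<sigma> ` (proc_fv CS P - {x})) x in Local x' (proc_subst CS (\<sigma>(x := x')) P))"
| "proc_subst CS \<sigma> (Call p xs) = Call p (map \<sigma> xs)"

text \<open>All index sets of sums are nonempty.\<close>

fun wf_proc :: "('v, 'a, 'p) proc \<Rightarrow> bool" where
  "wf_proc Skip = True"
| "wf_proc (Tell c) = True"
| "wf_proc (Sum bs) = (bs \<noteq> [] \<and> (\<forall>(c, P)\<in>set bs. wf_proc P))"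
| "wf_proc (Par P Q) = (wf_proc P \<and> wf_proc Q)"
| "wf_proc (Local x P) = wf_proc P"
| "wf_proc (Call p xs) = True"

text \<open>\<open>(p, ys, P) \<in> D\<close> stands for the definition of \<open>p(ys)\<close> as \<open>P\<close>.\<close>

definition wf_defs :: "('v, 'a, 'c) csystem \<Rightarrow> ('p \<times> 'v list \<times> ('v, 'a, 'p) proc) set \<Rightarrow> bool" where
  "wf_defs CS D \<longleftrightarrow>
     (\<forall>(p, ys, P)\<in>D. distinct ys \<and> proc_fv CS P \<subseteq> set ys \<and> wf_proc P)"

definition param_subst :: "'v list \<Rightarrow> 'v list \<Rightarrow> 'v \<Rightarrow> 'v" where
  "param_subst ys xs v = (case map_of (zip ys xs) v of None \<Rightarrow> v | Some x \<Rightarrow> x)"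

inductive proc_cong ::
  "('v, 'a, 'c) csystem \<Rightarrow> ('v, 'a, 'p) proc \<Rightarrow> ('v, 'a, 'p) proc \<Rightarrow> bool" for CS where
  refl: "proc_cong CS P P"
| sym: "proc_cong CS P Q \<Longrightarrow> proc_cong CS Q P"
| trans: "proc_cong CS P Q \<Longrightarrow> proc_cong CS Q R \<Longrightarrow> proc_cong CS P R"
| alpha: "y \<notin> proc_fv CS P \<Longrightarrow> proc_cong CS (Local x P) (Local y (proc_subst CS (id(x := y)) P))"
| par_comm: "proc_cong CS (Par P Q) (Par Q P)"
| par_assoc: "proc_cong CS (Par P (Par Q R)) (Par (Par P Q) R)"
| par_skip: "proc_cong CS (Par P Skip) P"
| tell: "con_alpha CS c c' \<Longrightarrow> proc_cong CS (Tell c) (Tell c')"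
| sum: "con_alpha CS c c' \<Longrightarrow> proc_cong CS P P' \<Longrightarrow>
    proc_cong CS (Sum (bs @ (c, P) # bs')) (Sum (bs @ (c', P') # bs'))"
| par: "proc_cong CS P P' \<Longrightarrow> proc_cong CS Q Q' \<Longrightarrow> proc_cong CS (Par P Q) (Par P' Q')"
| local: "proc_cong CS P P' \<Longrightarrow> proc_cong CS (Local x P) (Local x P')"


section \<open>Standard semantics\<close>

type_synonym ('v, 'a, 'p) std_config = "'v set \<times> ('v, 'a, 'p) proc multiset \<times> ('v, 'a) con"

definition mset_fv :: "('v, 'a, 'c) csystem \<Rightarrow> ('v, 'a, 'p) proc multiset \<Rightarrow> 'v set" where
  "mset_fv CS \<Gamma> = (\<Union>P\<in>set_mset \<Gamma>. proc_fv CS P)"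

definition par_list :: "('v, 'a, 'p) proc list \<Rightarrow> ('v, 'a, 'p) proc" where
  "par_list Ps = foldr Par Ps Skip"

text \<open>A multiset represents the parallel composition of its elements, taken in any order.\<close>

definition mset_cong ::
  "('v, 'a, 'c) csystem \<Rightarrow> ('v, 'a, 'p) proc multiset \<Rightarrow> ('v, 'a, 'p) proc multiset \<Rightarrow> bool" where
  "mset_cong CS \<Gamma> \<Gamma>' \<longleftrightarrow>
     (\<exists>Ps Qs. mset Ps = \<Gamma> \<and> mset Qs = \<Gamma>' \<and> proc_cong CS (par_list Ps) (par_list Qs))"

fun std_cong ::
  "('v, 'a, 'c::complete_lattice) csystem \<Rightarrow> ('v, 'a, 'p) std_config \<Rightarrow> ('v, 'a, 'p) std_config \<Rightarrow> bool" where
  "std_cong CS (X, \<Gamma>, c) (X', \<Gamma>', c') \<longleftrightarrow>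
     X = X' \<and> mset_cong CS \<Gamma> \<Gamma>' \<and>
     entails (con_sem CS c) (con_sem CS c') \<and> entails (con_sem CS c') (con_sem CS c)"

inductive std_step ::
  "('v, 'a, 'c::complete_lattice) csystem \<Rightarrow> ('p \<times> 'v list \<times> ('v, 'a, 'p) proc) set \<Rightarrow>
   ('v, 'a, 'p) std_config \<Rightarrow> ('v, 'a, 'p) std_config \<Rightarrow> bool" for CS D where
  tell: "std_step CS D (X, add_mset (Tell c) \<Gamma>, d) (X, add_mset Skip \<Gamma>, Conj c d)"
| sum: "(c, P) \<in> set bs \<Longrightarrow> entails (con_sem CS d) (con_sem CS c) \<Longrightarrow>
    std_step CS D (X, add_mset (Sum bs) \<Gamma>, d) (X, add_mset P \<Gamma>, d)"
| local: "x \<notin> X \<union> con_fv CS d \<union> mset_fv CS \<Gamma> \<Longrightarrow>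
    std_step CS D (X, add_mset (Local x P) \<Gamma>, d) (X \<union> {x}, add_mset P \<Gamma>, d)"
| call: "(p, ys, P) \<in> D \<Longrightarrow> length xs = length ys \<Longrightarrow>
    std_step CS D (X, add_mset (Call p xs) \<Gamma>, d)
      (X, add_mset (proc_subst CS (param_subst ys xs) P) \<Gamma>, d)"
| equiv: "std_cong CS \<gamma> \<gamma>' \<Longrightarrow> std_step CS D \<gamma>' \<delta>' \<Longrightarrow> std_cong CS \<delta>' \<delta> \<Longrightarrow> std_step CS D \<gamma> \<delta>"


section \<open>Collecting semantics\<close>

type_synonym ('v, 'a, 'p) tagged = "(('v, 'a, 'p) proc \<times> nat) list"

type_synonym ('v, 'a, 'p) coll_config = "'v set \<times> ('v, 'a, 'p) tagged \<times> ('v, 'a) con set"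

definition ids :: "('v, 'a, 'p) tagged \<Rightarrow> nat set" where
  "ids \<Gamma> = set (map snd \<Gamma>)"

definition tagged_fv :: "('v, 'a, 'c) csystem \<Rightarrow> ('v, 'a, 'p) tagged \<Rightarrow> 'v set" where
  "tagged_fv CS \<Gamma> = (\<Union>(P, i)\<in>set \<Gamma>. proc_fv CS P)"

definition store_fv :: "('v, 'a, 'c) csystem \<Rightarrow> ('v, 'a) con set \<Rightarrow> 'v set" where
  "store_fv CS S = (\<Union>c\<in>S. con_fv CS c)"

definition store_sem :: "('v, 'a, 'c::complete_lattice) csystem \<Rightarrow> ('v, 'a) con set \<Rightarrow> 'c" where
  "store_sem CS S = (SUP c\<in>S. con_sem CS c)"

definition fvars :: "('v, 'a, 'c) csystem \<Rightarrow> 'v set \<Rightarrow> ('v, 'a) con set \<Rightarrow>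
    ('v, 'a, 'p) tagged \<Rightarrow> ('v, 'a, 'p) tagged \<Rightarrow> 'v set" where
  "fvars CS X S \<Gamma> \<Gamma>' = X \<union> store_fv CS S \<union> tagged_fv CS \<Gamma> \<union> tagged_fv CS \<Gamma>'"

text \<open>Splitting one binary parallel composition; the identification of an n-ary one with a sequence
  is obtained by iteration.\<close>

inductive par_split :: "('v, 'a, 'p) tagged \<Rightarrow> ('v, 'a, 'p) tagged \<Rightarrow> bool" where
  "distinct (i # j # k # map snd (\<Gamma> @ \<Gamma>')) \<Longrightarrow>
    par_split (\<Gamma> @ [(Par P Q, i)] @ \<Gamma>') (\<Gamma> @ [(P, j), (Q, k)] @ \<Gamma>')"

fun coll_ident :: "('v, 'a, 'p) coll_config \<Rightarrow> ('v, 'a, 'p) coll_config \<Rightarrow> bool" where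
  "coll_ident (X, \<Gamma>, S) (X', \<Gamma>', S') \<longleftrightarrow> X = X' \<and> equivclp par_split \<Gamma> \<Gamma>' \<and> S = S'"

text \<open>In \<open>local\<close>, the bound variable is alpha-converted to \<open>x'\<close>, so \<open>x'\<close> must not be free in
  \<open>Local x P\<close> either, whose free variables \<open>fvars\<close> does not include.\<close>

inductive coll_step ::
  "('v, 'a, 'c::complete_lattice) csystem \<Rightarrow> ('p \<times> 'v list \<times> ('v, 'a, 'p) proc) set \<Rightarrow>
   ('v, 'a, 'p) coll_config \<Rightarrow> ('v, 'a, 'p) coll_config \<Rightarrow> bool" for CS D where
  tell: "(Y, Sc) \<in> atoms CS c (fvars CS X S \<Gamma> \<Gamma>') \<Longrightarrow>
    coll_step CS D (X, \<Gamma> @ [(Tell c, i)] @ \<Gamma>', S) (X \<union> Y, \<Gamma> @ \<Gamma>', S \<union> Sc)"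
| sum: "(c, P) \<in> set bs \<Longrightarrow> entails (store_sem CS S) (con_sem CS c) \<Longrightarrow>
    j \<notin> ids (\<Gamma> @ [(Sum bs, i)] @ \<Gamma>') \<Longrightarrow>
    coll_step CS D (X, \<Gamma> @ [(Sum bs, i)] @ \<Gamma>', S) (X, \<Gamma> @ [(P, j)] @ \<Gamma>', S)"
| local: "x' \<notin> fvars CS X S \<Gamma> \<Gamma>' \<Longrightarrow> x' \<notin> proc_fv CS (Local x P) \<Longrightarrow>
    j \<notin> ids (\<Gamma> @ [(Local x P, i)] @ \<Gamma>') \<Longrightarrow>
    coll_step CS D (X, \<Gamma> @ [(Local x P, i)] @ \<Gamma>', S)
      (X \<union> {x'}, \<Gamma> @ [(proc_subst CS (id(x := x')) P, j)] @ \<Gamma>', S)"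
| call: "(p, ys, P) \<in> D \<Longrightarrow> length xs = length ys \<Longrightarrow>
    j \<notin> ids (\<Gamma> @ [(Call p xs, i)] @ \<Gamma>') \<Longrightarrow>
    coll_step CS D (X, \<Gamma> @ [(Call p xs, i)] @ \<Gamma>', S)
      (X, \<Gamma> @ [(proc_subst CS (param_subst ys xs) P, j)] @ \<Gamma>', S)"
| ident: "coll_ident \<gamma> \<gamma>' \<Longrightarrow> coll_step CS D \<gamma>' \<delta>' \<Longrightarrow> coll_ident \<delta>' \<delta> \<Longrightarrow> coll_step CS D \<gamma> \<delta>"

end

theory Submission
  imports Defs
begin

text \<open>
  Structural congruence is eliminated by canonical forms: a binder becomes a function from
  variables to forms, and a parallel composition becomes a multiset.  Congruent processes have
  equal canonical forms, and substitution acts on forms by composition of environments.  Two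
  constraints with equal forms have the same meaning, and substitution preserves semantic
  entailment, because on finitely many variables it is a composition of the single substitutions
  that the diagonal elements express.

  Every step of one semantics is matched by one step of the other.  The collecting store \<open>S\<close> and
  the standard store \<open>d\<close> are related by \<open>d = \<exists>Y. S\<close>, where \<open>Y\<close> collects the bound variables of the
  constraints told so far; they occur in no process, so both stores entail the same guards.
  A collecting run is matched with the same hidden variables.  In the other direction the standard
  semantics has more freedom, since it may replace its store by an equivalent one, and the
  hidden variables are matched up to a renaming.
\<close>

section \<open>Canonical forms modulo structural congruence\<close>

text \<open>A quantifier carries a function rather than a name and a body, so alpha-equivalent
  constraints can have literally the same form.\<close>

datatype ('v, 'a) con_form =
    CTok 'a
  | CTT
  | CFF
  | CDiag 'v 'v
  | CConj "('v, 'a) con_form" "('v, 'a) con_form"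
  | CExi "'v \<Rightarrow> ('v, 'a) con_form"

fun con_nf :: "('v, 'a, 'c) csystem \<Rightarrow> ('v, 'a) con \<Rightarrow> ('v \<Rightarrow> 'v) \<Rightarrow> ('v, 'a) con_form" where
  "con_nf CS (Tok a) \<sigma> = CTok (tok_subst CS \<sigma> a)"
| "con_nf CS TT \<sigma> = CTT"
| "con_nf CS FF \<sigma> = CFF"
| "con_nf CS (Diag x y) \<sigma> = CDiag (\<sigma> x) (\<sigma> y)"
| "con_nf CS (Conj c d) \<sigma> = CConj (con_nf CS c \<sigma>) (con_nf CS d \<sigma>)"
| "con_nf CS (Exi x c) \<sigma> = CExi (\<lambda>y. con_nf CS c (\<sigma>(x := y)))"

text \<open>The laws of parallel composition become identities between multisets:
  \<open>Skip\<close> is the empty multiset and \<open>Par\<close> is union, so neither has a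
  constructor. Branches of a sum stay in a list, since structural congruence does not permute
  them.\<close>

datatype ('v, 'a, 'p) proc_form =
    PTell "('v, 'a) con_form"
  | PSum "(('v, 'a) con_form \<times> ('v, 'a, 'p) proc_form multiset) list"
  | PLocal "'v \<Rightarrow> ('v, 'a, 'p) proc_form multiset"
  | PCall 'p "'v list"

fun proc_nf :: "('v, 'a, 'c) csystem \<Rightarrow> ('v, 'a, 'p) proc \<Rightarrow> ('v \<Rightarrow> 'v) \<Rightarrow>
    ('v, 'a, 'p) proc_form multiset" where
  "proc_nf CS Skip \<sigma> = {#}"
| "proc_nf CS (Tell c) \<sigma> = {#PTell (con_nf CS c \<sigma>)#}"
| "proc_nf CS (Sum bs) \<sigma> = {#PSum (map (\<lambda>(c, P). (con_nf CS c \<sigma>, proc_nf CS P \<sigma>)) bs)#}"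
| "proc_nf CS (Par P Q) \<sigma> = proc_nf CS P \<sigma> + proc_nf CS Q \<sigma>"
| "proc_nf CS (Local x P) \<sigma> = {#PLocal (\<lambda>y. proc_nf CS P (\<sigma>(x := y)))#}"
| "proc_nf CS (Call p xs) \<sigma> = {#PCall p (map \<sigma> xs)#}"

lemma id_upd_id [simp]: "id(x := x) = id"
  by auto

lemma avoid_notin:
  fixes x :: "'v::infinite"
  assumes "finite V"
  shows "avoid V x \<notin> V"
proof -
  have "\<exists>y. y \<notin> V" using assms ex_new_if_finite infinite_UNIV by blast
  then have "(SOME y. y \<notin> V) \<notin> V" by (rule someI_ex)
  then show ?thesis by (simp add: avoid_def)
qed

text \<open>Induction on the size can therefore pass to a renamed body of a quantifier, which is no
  subterm.\<close>

lemma size_con_subst [simp]: "size (con_subst CS \<sigma> c) = size c"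
  by (induction c arbitrary: \<sigma>) (auto simp: Let_def)

text \<open>Induction for the nested datatype with branches given as members of a list instead of
  components of pairs.\<close>

lemma proc_induct [case_names Skip Tell Sum Par Local Call]:
  assumes "Q Skip" "\<And>c. Q (Tell c)"
    and "\<And>bs. (\<And>c P. (c, P) \<in> set bs \<Longrightarrow> Q P) \<Longrightarrow> Q (Sum bs)"
    and "\<And>P P'. Q P \<Longrightarrow> Q P' \<Longrightarrow> Q (Par P P')"
    and "\<And>x P. Q P \<Longrightarrow> Q (Local x P)" "\<And>p xs. Q (Call p xs)"
  shows "Q P"
  by (induction P) (use assms in auto)

context constraint_language
begin

section \<open>Constraints: substitution, forms and alpha conversion\<close>

lemma finite_con_fv [simp]: "finite (con_fv CS c)"
  by (induction c) (auto simp: finite_tok_fv)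

lemma con_fv_subst: "con_fv CS (con_subst CS \<sigma> c) = \<sigma> ` con_fv CS c"
proof (induction c arbitrary: \<sigma>)
  case (Exi x c)
  define x' where "x' = avoid (\<sigma> ` (con_fv CS c - {x})) x"
  have "x' \<notin> \<sigma> ` (con_fv CS c - {x})"
    unfolding x'_def by (rule avoid_notin) simp
  then show ?case by (auto simp: Let_def x'_def[symmetric] Exi)
qed (auto simp: tok_fv_subst)

lemma con_subst_id [simp]: "con_subst CS id c = c"
proof (induction c)
  case (Conj c d)
  have "con_subst CS id c = c" "con_subst CS id d = d" by (rule Conj)+
  then show "con_subst CS id (Conj c d) = Conj c d" by simp
next
  case (Exi x c)
  have "con_subst CS id c = c" by (rule Exi)
  then show "con_subst CS id (Exi x c) = Exi x c" by (simp add: avoid_def Let_def)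
qed (auto simp: tok_subst_id[unfolded id_def] id_def)

lemma con_nf_cong:
  "(\<And>x. x \<in> con_fv CS c \<Longrightarrow> \<sigma> x = \<tau> x) \<Longrightarrow> con_nf CS c \<sigma> = con_nf CS c \<tau>"
proof (induction c arbitrary: \<sigma> \<tau>)
  case (Tok a)
  then show ?case by (auto intro: tok_subst_cong)
next
  case (Exi x c)
  have "con_nf CS c (\<sigma>(x := y)) = con_nf CS c (\<tau>(x := y))" for y
    by (rule Exi.IH) (use Exi.prems in auto)
  then show ?case by simp
next
  case (Conj c d)
  have "con_nf CS c \<sigma> = con_nf CS c \<tau>" "con_nf CS d \<sigma> = con_nf CS d \<tau>"
    by (rule Conj.IH; simp add: Conj.prems)+
  then show ?case by simp
qed auto

text \<open>Capture avoidance is the reason: the binder chosen by the substitution lies outside the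
  image of the other free variables, so the two environments agree on the free variables of the
  body.\<close>

lemma con_nf_subst: "con_nf CS (con_subst CS \<sigma> c) \<tau> = con_nf CS c (\<tau> \<circ> \<sigma>)"
proof (induction c arbitrary: \<sigma> \<tau>)
  case (Exi x c)
  define x' where "x' = avoid (\<sigma> ` (con_fv CS c - {x})) x"
  have "x' \<notin> \<sigma> ` (con_fv CS c - {x})"
    unfolding x'_def by (rule avoid_notin) simp
  then have "con_nf CS c (\<tau>(x' := y) \<circ> \<sigma>(x := x')) = con_nf CS c ((\<tau> \<circ> \<sigma>)(x := y))" for y
    by (intro con_nf_cong) auto
  moreover have "con_nf CS (con_subst CS (\<sigma>(x := x')) c) (\<tau>(x' := y)) =
      con_nf CS c (\<tau>(x' := y) \<circ> \<sigma>(x := x'))" for y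
    by (rule Exi.IH)
  ultimately have "(\<lambda>y. con_nf CS (con_subst CS (\<sigma>(x := x')) c) (\<tau>(x' := y))) =
      (\<lambda>y. con_nf CS c ((\<tau> \<circ> \<sigma>)(x := y)))"
    by metis
  then show "con_nf CS (con_subst CS \<sigma> (Exi x c)) \<tau> = con_nf CS (Exi x c) (\<tau> \<circ> \<sigma>)"
    by (simp only: con_subst.simps con_nf.simps Let_def x'_def[symmetric])
qed (auto simp: tok_subst_comp)

text \<open>Lets an induction on the size of one constraint also cover a second one with the same
  form. For quantifiers it suffices to compare the two functions at a single argument.\<close>

lemma size_eq_if_con_nf_eq: "con_nf CS c \<sigma> = con_nf CS d \<tau> \<Longrightarrow> size c = size d"
proof (induction c arbitrary: d \<sigma> \<tau>)
  case (Conj c1 c2)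
  from Conj.prems obtain d1 d2 where d: "d = Conj d1 d2" by (cases d) auto
  have "size c1 = size d1" by (rule Conj.IH(1)[of \<sigma> _ \<tau>]) (use Conj.prems d in simp)
  moreover have "size c2 = size d2" by (rule Conj.IH(2)[of \<sigma> _ \<tau>]) (use Conj.prems d in simp)
  ultimately show ?case using d by simp
next
  case (Exi x c)
  from Exi.prems obtain y e where d: "d = Exi y e" by (cases d) auto
  have "(\<lambda>z. con_nf CS c (\<sigma>(x := z))) = (\<lambda>z. con_nf CS e (\<tau>(y := z)))"
    using Exi.prems d by simp
  then have "con_nf CS c (\<sigma>(x := x)) = con_nf CS e (\<tau>(y := x))" by (rule fun_cong)
  then have "size c = size e" by (rule Exi.IH)
  then show ?case using d by simp
next
  case (Tok a)
  then show ?case by (cases d) auto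
next
  case TT
  then show ?case by (cases d) auto
next
  case FF
  then show ?case by (cases d) auto
next
  case (Diag x y)
  then show ?case by (cases d) auto
qed

lemma con_nf_alpha: "con_alpha CS c d \<Longrightarrow> con_nf CS c \<sigma> = con_nf CS d \<sigma>"
proof (induction arbitrary: \<sigma> rule: con_alpha.induct)
  case (alpha y c x)
  have "con_nf CS c (\<sigma>(x := z)) = con_nf CS c (\<sigma>(y := z) \<circ> id(x := y))" for z
    using alpha by (intro con_nf_cong) auto
  then show ?case by (simp add: con_nf_subst)
qed auto

lemma con_alpha_fv: "con_alpha CS c d \<Longrightarrow> con_fv CS c = con_fv CS d"
  by (induction rule: con_alpha.induct) (auto simp: con_fv_subst)

lemma fv_basic_le: "store_fv CS (basic c) \<subseteq> con_fv CS c \<union> con_bv c"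
  by (induction c) (auto simp: store_fv_def con_bv_def)

lemma fv_le_basic: "con_fv CS c \<subseteq> store_fv CS (basic c)"
  by (induction c) (auto simp: store_fv_def)

lemma finite_basic [simp]: "finite (basic c)"
  by (induction c) auto

lemma finite_con_bv [simp]: "finite (con_bv c)"
  by (simp add: con_bv_def)

text \<open>Binders are chosen one after the other, and the forbidden set \<open>V\<close> grows by
  those already in use. The induction is on the size because the body of a quantifier is renamed
  before it is treated.\<close>

lemma ex_distinct_alpha:
  "finite V \<Longrightarrow> \<exists>c'. con_alpha CS c c' \<and> distinct (con_binders c') \<and> con_bv c' \<inter> V = {}"
proof (induction "size c" arbitrary: c V rule: less_induct)
  case less
  show ?case
  proof (cases c)
    case (Conj c1 c2)
    obtain c1' where 1: "con_alpha CS c1 c1'" "distinct (con_binders c1')" "con_bv c1' \<inter> V = {}"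
      using less.hyps[of c1 V] less.prems Conj by auto
    obtain c2' where 2: "con_alpha CS c2 c2'" "distinct (con_binders c2')"
        "con_bv c2' \<inter> (V \<union> con_bv c1') = {}"
      using less.hyps[of c2 "V \<union> con_bv c1'"] less.prems Conj by auto
    show ?thesis
      using 1 2 Conj by (intro exI[of _ "Conj c1' c2'"]) (auto intro: con_alpha.conj simp: con_bv_def)
  next
    case (Exi x b)
    obtain y where y: "y \<notin> V \<union> con_fv CS b"
      using less.prems by (metis ex_new_if_finite finite_UnI finite_con_fv infinite_UNIV)
    obtain b' where b': "con_alpha CS (con_subst CS (id(x := y)) b) b'" "distinct (con_binders b')"
        "con_bv b' \<inter> (insert y V) = {}"
      using less.hyps[of "con_subst CS (id(x := y)) b" "insert y V"] less.prems Exi by auto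
    have "con_alpha CS (Exi x b) (Exi y b')"
      using y b' by (meson UnI2 con_alpha.intros)
    then show ?thesis
      using y b' Exi by (intro exI[of _ "Exi y b'"]) (auto simp: con_bv_def)
  qed (auto intro!: exI[of _ c] con_alpha.refl simp: con_bv_def)
qed

section \<open>Processes: substitution, forms and structural congruence\<close>

lemma finite_proc_fv [simp]: "finite (proc_fv CS P)"
  by (induction P rule: proc_induct) auto

lemma proc_fv_subst: "proc_fv CS (proc_subst CS \<sigma> P) = \<sigma> ` proc_fv CS P"
proof (induction P arbitrary: \<sigma> rule: proc_induct)
  case (Sum bs)
  have "con_fv CS (con_subst CS \<sigma> (fst b)) \<union> proc_fv CS (proc_subst CS \<sigma> (snd b)) =
      \<sigma> ` (con_fv CS (fst b) \<union> proc_fv CS (snd b))" if "b \<in> set bs" for b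
    using that Sum[of "fst b" "snd b" \<sigma>] by (simp add: con_fv_subst image_Un)
  then show ?case by (simp add: case_prod_beta image_UN)
next
  case (Local x P)
  define x' where "x' = avoid (\<sigma> ` (proc_fv CS P - {x})) x"
  have "x' \<notin> \<sigma> ` (proc_fv CS P - {x})"
    unfolding x'_def by (rule avoid_notin) simp
  then show ?case by (auto simp: Let_def x'_def[symmetric] Local)
qed (auto simp: con_fv_subst)

lemma proc_subst_id [simp]: "proc_subst CS id P = P"
proof (induction P rule: proc_induct)
  case (Sum bs)
  have "proc_subst CS id P = P" if "(c, P) \<in> set bs" for c P by (rule Sum) (rule that)
  then show "proc_subst CS id (Sum bs) = Sum bs" by (auto intro!: map_idI)
next
  case (Par P Q)
  have "proc_subst CS id P = P" "proc_subst CS id Q = Q" by (rule Par)+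
  then show "proc_subst CS id (Par P Q) = Par P Q" by simp
next
  case (Local x P)
  have "proc_subst CS id P = P" by (rule Local)
  then show "proc_subst CS id (Local x P) = Local x P" by (simp add: avoid_def Let_def)
next
  case (Tell c)
  show "proc_subst CS id (Tell c) = Tell c" by simp
qed auto

lemma proc_nf_cong:
  "(\<And>x. x \<in> proc_fv CS P \<Longrightarrow> \<sigma> x = \<tau> x) \<Longrightarrow> proc_nf CS P \<sigma> = proc_nf CS P \<tau>"
proof (induction P arbitrary: \<sigma> \<tau> rule: proc_induct)
  case (Tell c)
  then show ?case by (auto intro: con_nf_cong)
next
  case (Sum bs)
  have "con_nf CS c \<sigma> = con_nf CS c \<tau> \<and> proc_nf CS P \<sigma> = proc_nf CS P \<tau>" if cP: "(c, P) \<in> set bs" for c P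
  proof -
    have "con_fv CS c \<union> proc_fv CS P \<subseteq> proc_fv CS (Sum bs)"
      using cP by (auto intro!: bexI[of _ "(c, P)"])
    then show ?thesis
      using Sum.prems by (intro conjI con_nf_cong Sum.IH[OF cP]) blast+
  qed
  then show ?case by auto
next
  case (Par P Q)
  have "proc_nf CS P \<sigma> = proc_nf CS P \<tau>" "proc_nf CS Q \<sigma> = proc_nf CS Q \<tau>"
    by (rule Par.IH; simp add: Par.prems)+
  then show ?case by simp
next
  case (Local x P)
  have "proc_nf CS P (\<sigma>(x := y)) = proc_nf CS P (\<tau>(x := y))" for y
    by (rule Local.IH) (use Local.prems in auto)
  then show ?case by simp
qed auto

lemma proc_nf_subst: "proc_nf CS (proc_subst CS \<sigma> P) \<tau> = proc_nf CS P (\<tau> \<circ> \<sigma>)"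
proof (induction P arbitrary: \<sigma> \<tau> rule: proc_induct)
  case (Sum bs)
  have "proc_nf CS (proc_subst CS \<sigma> P) \<tau> = proc_nf CS P (\<tau> \<circ> \<sigma>)" if "(c, P) \<in> set bs" for c P
    by (rule Sum) (rule that)
  then show "proc_nf CS (proc_subst CS \<sigma> (Sum bs)) \<tau> = proc_nf CS (Sum bs) (\<tau> \<circ> \<sigma>)"
    by (auto simp: con_nf_subst)
next
  case (Local x P)
  define x' where "x' = avoid (\<sigma> ` (proc_fv CS P - {x})) x"
  have "x' \<notin> \<sigma> ` (proc_fv CS P - {x})"
    unfolding x'_def by (rule avoid_notin) simp
  then have "proc_nf CS P (\<tau>(x' := y) \<circ> \<sigma>(x := x')) = proc_nf CS P ((\<tau> \<circ> \<sigma>)(x := y))" for y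
    by (intro proc_nf_cong) auto
  moreover have "proc_nf CS (proc_subst CS (\<sigma>(x := x')) P) (\<tau>(x' := y)) =
      proc_nf CS P (\<tau>(x' := y) \<circ> \<sigma>(x := x'))" for y
    by (rule Local.IH)
  ultimately have "(\<lambda>y. proc_nf CS (proc_subst CS (\<sigma>(x := x')) P) (\<tau>(x' := y))) =
      (\<lambda>y. proc_nf CS P ((\<tau> \<circ> \<sigma>)(x := y)))"
    by metis
  then show "proc_nf CS (proc_subst CS \<sigma> (Local x P)) \<tau> = proc_nf CS (Local x P) (\<tau> \<circ> \<sigma>)"
    by (simp only: proc_subst.simps proc_nf.simps Let_def x'_def[symmetric])
qed (auto simp: con_nf_subst)

text \<open>The parallel laws hold as multiset identities. Alpha conversion to a name not free in
  the body changes the environment only outside the free variables of the body.\<close>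

lemma proc_nf_cong_eq: "proc_cong CS P Q \<Longrightarrow> proc_nf CS P \<sigma> = proc_nf CS Q \<sigma>"
proof (induction arbitrary: \<sigma> rule: proc_cong.induct)
  case (alpha y P x)
  have "proc_nf CS P (\<sigma>(x := z)) = proc_nf CS P (\<sigma>(y := z) \<circ> id(x := y))" for z
    using alpha by (intro proc_nf_cong) auto
  then show ?case by (simp add: proc_nf_subst)
qed (auto simp: con_nf_alpha)

lemma proc_cong_fv: "proc_cong CS P Q \<Longrightarrow> proc_fv CS P = proc_fv CS Q"
  by (induction rule: proc_cong.induct) (auto simp: proc_fv_subst con_alpha_fv)

section \<open>Semantics of substitution\<close>

lemma ex_bot [simp]: "ex CS x bot = bot"
  using ex_le[of x bot] by (simp add: bot_unique)

lemma ex_idem [simp]: "ex CS x (ex CS x c) = ex CS x c"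
  using ex_sup_ex[of x bot c] by simp

lemma ex_sup_closed: "ex CS x b = b \<Longrightarrow> ex CS x (sup a b) = sup (ex CS x a) b"
  using ex_sup_ex[of x a b] by simp

lemma ex_diag [simp]: "z \<noteq> x \<Longrightarrow> z \<noteq> y \<Longrightarrow> ex CS z (diag CS x y) = diag CS x y"
  by (metis diag_trans ex_idem)

text \<open>Passing from \<open>y\<close> to \<open>y\<close> through \<open>x\<close> gives
  \<open>bot\<close> as the value of \<open>ex\<close> at \<open>x\<close> on the join of the two
  diagonals, and this bounds the left side.\<close>

lemma ex_diag_left [simp]: "x \<noteq> y \<Longrightarrow> ex CS x (diag CS x y) = bot"
  using diag_trans[of x y y] ex_mono[of "diag CS x y" "sup (diag CS y x) (diag CS x y)" x]
  by (simp add: diag_refl bot_unique)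

text \<open>In \<open>diag_subst\<close> with \<open>c\<close> the reversed diagonal, the quantified
  part equals \<open>diag CS y y\<close>, which is \<open>bot\<close>.\<close>

lemma diag_sym: "diag CS x y = diag CS y x"
proof -
  have "diag CS y x \<le> diag CS x y" if "x \<noteq> y" for x y
    using diag_subst[OF that, of "diag CS y x"] diag_trans[of x y y] that by (simp add: diag_refl)
  then show ?thesis by (metis order_antisym)
qed

lemma ex_diag_right [simp]: "x \<noteq> y \<Longrightarrow> ex CS y (diag CS x y) = bot"
  by (metis diag_sym ex_diag_left)

lemma ex_con_sem: "x \<notin> con_fv CS c \<Longrightarrow> ex CS x (con_sem CS c) = con_sem CS c"
proof (induction c)
  case (Exi y c)
  then show ?case by (cases "x = y") (auto simp: ex_commute[of x y])
qed (auto simp: ex_tok ex_top ex_sup_closed)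

text \<open>Substitution commutes with conjunction. By \<open>diag_subst\<close>, the two
  substituted constraints together with the diagonal recover \<open>a\<close> and \<open>b\<close>;
  quantifying \<open>x\<close> then removes the diagonal and leaves the substituted constraints
  alone.\<close>

lemma ex_sup_diag:
  assumes "x \<noteq> y"
  shows "ex CS x (sup (sup a b) (diag CS x y)) =
    sup (ex CS x (sup a (diag CS x y))) (ex CS x (sup b (diag CS x y)))" (is "?l = sup ?a ?b")
proof (rule order_antisym)
  have "a \<le> sup (diag CS x y) (sup ?a ?b)"
    by (rule order_trans[OF diag_subst[OF assms]]) (intro sup_mono order_refl sup_ge1)
  moreover have "b \<le> sup (diag CS x y) (sup ?a ?b)"
    by (rule order_trans[OF diag_subst[OF assms]]) (intro sup_mono order_refl sup_ge2)
  ultimately have "sup (sup a b) (diag CS x y) \<le> sup (diag CS x y) (sup ?a ?b)"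
    by (intro sup_least sup_ge1)
  then have "?l \<le> ex CS x (sup (diag CS x y) (sup ?a ?b))" by (rule ex_mono)
  also have "\<dots> = sup ?a ?b" using assms by (simp add: ex_sup_closed)
  finally show "?l \<le> sup ?a ?b" .
qed (auto intro!: ex_mono sup.mono)

text \<open>The semantic form of alpha conversion: after exchanging the quantifiers,
  \<open>w\<close> occurs only in the diagonal, which \<open>ex\<close> at \<open>w\<close> turns
  into \<open>bot\<close>.\<close>

lemma ex_rename:
  assumes "ex CS w b = b" "w \<noteq> z"
  shows "ex CS w (ex CS z (sup b (diag CS z w))) = ex CS z b"
proof -
  have "ex CS w (sup (diag CS z w) b) = b"
    using assms by (simp add: ex_sup_closed)
  then have "ex CS w (sup b (diag CS z w)) = b" by (simp add: sup_commute)
  then show ?thesis by (simp add: ex_commute[of w z])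
qed

text \<open>If exactly one of \<open>u\<close> and \<open>v\<close> is \<open>x\<close>, this is
  transitivity of the diagonals with \<open>x\<close> as intermediate variable.\<close>

lemma con_sem_diag_subst:
  assumes "x \<noteq> y"
  shows "diag CS ((id(x := y)) u) ((id(x := y)) v) = ex CS x (sup (diag CS u v) (diag CS x y))"
proof (cases "u = x \<or> v = x")
  case False
  then have "x \<noteq> u" "x \<noteq> v" by auto
  then show ?thesis
    using assms ex_sup_closed[of x "diag CS u v" "diag CS x y"] by (simp add: sup_commute)
next
  case True
  have *: "diag CS y v = ex CS x (sup (diag CS x v) (diag CS x y))" if "v \<noteq> x" for v
    using diag_trans[of x y v] assms that by (simp add: diag_sym[of y x] sup_commute)
  show ?thesis using True assms *[of u] *[of v]
    by (cases "u = x"; cases "v = x") (auto simp: diag_refl diag_sym[of u])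
qed

text \<open>The two parts need each other: substituting below a binder may rename the binder, and the
  resulting simultaneous substitution is split into single ones by comparing canonical forms.\<close>

lemma con_sem_subst_and_nf:
  "(\<forall>x y. x \<noteq> y \<longrightarrow>
      con_sem CS (con_subst CS (id(x := y)) c) = ex CS x (sup (con_sem CS c) (diag CS x y))) \<and>
   (\<forall>d. con_nf CS c id = con_nf CS d id \<longrightarrow> con_sem CS c = con_sem CS d)"
proof (induction "size c" arbitrary: c rule: less_induct)
  case less
  note A = less[THEN conjunct1, rule_format] and B = less[THEN conjunct2, rule_format]
  \<comment> \<open>For smaller constraints the first part expresses a single substitution by a
    diagonal, so \<open>ex_rename\<close> justifies a change of bound variable.\<close>
  have rename: "ex CS w (con_sem CS (con_subst CS (id(z := w)) b)) = ex CS z (con_sem CS b)"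
    if "size b < size c" "w \<notin> con_fv CS b" "w \<noteq> z" for w z b
    using that by (simp add: A ex_rename ex_con_sem)
  show ?case
  proof (cases c)
    case (Tok a)
    have "con_sem CS c = con_sem CS d" if "con_nf CS c id = con_nf CS d id" for d
      using that Tok by (cases d) (auto simp: tok_subst_id)
    then show ?thesis using Tok by (simp add: tok_sem_subst)
  next
    case TT
    have "con_sem CS c = con_sem CS d" if "con_nf CS c id = con_nf CS d id" for d
      using that TT by (cases d) auto
    then show ?thesis using TT by simp
  next
    case FF
    have "con_sem CS c = con_sem CS d" if "con_nf CS c id = con_nf CS d id" for d
      using that FF by (cases d) auto
    then show ?thesis using FF by (simp add: ex_top)
  next
    case (Diag u v)
    have "con_sem CS c = con_sem CS d" if "con_nf CS c id = con_nf CS d id" for d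
      using that Diag by (cases d) auto
    then show ?thesis using Diag by (auto simp: con_sem_diag_subst simp del: fun_upd_apply)
  next
    case (Conj c1 c2)
    have "con_sem CS c = con_sem CS d" if "con_nf CS c id = con_nf CS d id" for d
    proof -
      from that Conj obtain d1 d2 where d: "d = Conj d1 d2" by (cases d) auto
      have "con_sem CS c1 = con_sem CS d1" "con_sem CS c2 = con_sem CS d2"
        by (rule B, use that Conj d in auto)+
      then show ?thesis using Conj d by simp
    qed
    then show ?thesis using Conj by (simp add: A ex_sup_diag)
  next
    case (Exi z b)
    have lt: "size b < size c" using Exi by simp
    have "con_sem CS (con_subst CS (id(x := y)) c) = ex CS x (sup (con_sem CS c) (diag CS x y))"
      if "x \<noteq> y" for x y
    proof -
      define z' where "z' = avoid ((id(x := y)) ` (con_fv CS b - {z})) z"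
      define \<sigma> where "\<sigma> = (id(x := y))(z := z')"
      have z': "z' \<notin> (id(x := y)) ` (con_fv CS b - {z})"
        unfolding z'_def by (rule avoid_notin) simp
      have subst: "con_subst CS (id(x := y)) c = Exi z' (con_subst CS \<sigma> b)"
        using Exi by (simp add: Let_def z'_def \<sigma>_def)
      \<comment> \<open>Both sides are brought to a common binder \<open>w\<close>, away from all
        variables involved. Substituting below it is then a single substitution without
        capture.\<close>
      obtain w where w: "w \<notin> con_fv CS b \<union> con_fv CS (con_subst CS \<sigma> b) \<union> {x, y, z, z'}"
        using ex_new_if_finite[OF infinite_UNIV, of "con_fv CS b \<union> con_fv CS (con_subst CS \<sigma> b) \<union> {x, y, z, z'}"]
        by auto
      \<comment> \<open>Renaming the binder after or before the substitution gives the same form,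
        which the second part of the hypothesis turns into equal meaning.\<close>
      have "con_nf CS (con_subst CS (id(z' := w)) (con_subst CS \<sigma> b)) id =
          con_nf CS (con_subst CS (id(x := y)) (con_subst CS (id(z := w)) b)) id"
        unfolding con_nf_subst by (rule con_nf_cong) (use w z' in \<open>auto simp: \<sigma>_def\<close>)
      then have eq: "con_sem CS (con_subst CS (id(z' := w)) (con_subst CS \<sigma> b)) =
          con_sem CS (con_subst CS (id(x := y)) (con_subst CS (id(z := w)) b))"
        using lt by (intro B) auto
      have "con_sem CS (Exi z' (con_subst CS \<sigma> b)) =
          ex CS w (con_sem CS (con_subst CS (id(z' := w)) (con_subst CS \<sigma> b)))"
        using w lt by (simp add: rename)
      also have "\<dots> = ex CS w (ex CS x (sup (con_sem CS (con_subst CS (id(z := w)) b)) (diag CS x y)))"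
        using lt \<open>x \<noteq> y\<close> by (simp add: eq A)
      also have "\<dots> = ex CS x (ex CS w (sup (con_sem CS (con_subst CS (id(z := w)) b)) (diag CS x y)))"
        by (rule ex_commute)
      also have "\<dots> = ex CS x (sup (ex CS z (con_sem CS b)) (diag CS x y))"
        using w lt by (simp add: ex_sup_closed rename)
      finally show ?thesis using Exi subst by simp
    qed
    moreover have "con_sem CS c = con_sem CS d" if nf: "con_nf CS c id = con_nf CS d id" for d
    proof -
      from nf Exi obtain z' b' where d: "d = Exi z' b'" by (cases d) auto
      obtain w where w: "w \<notin> con_fv CS b \<union> con_fv CS b' \<union> {z, z'}"
        using ex_new_if_finite[OF infinite_UNIV, of "con_fv CS b \<union> con_fv CS b' \<union> {z, z'}"] by auto
      have "con_nf CS (con_subst CS (id(z := w)) b) id = con_nf CS (con_subst CS (id(z' := w)) b') id"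
      proof -
        have "(\<lambda>y. con_nf CS b (id(z := y))) = (\<lambda>y. con_nf CS b' (id(z' := y)))"
          using nf Exi d by simp
        then have "con_nf CS b (id(z := w)) = con_nf CS b' (id(z' := w))" by (rule fun_cong)
        then show ?thesis by (simp add: con_nf_subst)
      qed
      then have "con_sem CS (con_subst CS (id(z := w)) b) = con_sem CS (con_subst CS (id(z' := w)) b')"
        using lt by (intro B) auto
      \<comment> \<open>\<open>rename\<close> applies to smaller bodies only; \<open>b'\<close> is
        one because equal forms have equal size.\<close>
      moreover have "size b' < size c"
        using size_eq_if_con_nf_eq[OF nf] d by simp
      ultimately show ?thesis
        using Exi d rename[of b w z] rename[of b' w z'] w lt by auto
    qed
    ultimately show ?thesis by blast
  qed
qed

section \<open>Substitution as a monotone operation on meanings\<close>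

lemma con_sem_subst_single:
  "x \<noteq> y \<Longrightarrow> con_sem CS (con_subst CS (id(x := y)) c) = ex CS x (sup (con_sem CS c) (diag CS x y))"
  using con_sem_subst_and_nf by blast

lemma con_sem_eq_if_nf_eq: "con_nf CS c id = con_nf CS d id \<Longrightarrow> con_sem CS c = con_sem CS d"
  using con_sem_subst_and_nf by blast

lemma con_sem_alpha: "con_alpha CS c d \<Longrightarrow> con_sem CS c = con_sem CS d"
  by (rule con_sem_eq_if_nf_eq) (rule con_nf_alpha)

lemma con_sem_subst_cong:
  "(\<And>x. x \<in> con_fv CS c \<Longrightarrow> \<sigma> x = \<tau> x) \<Longrightarrow>
    con_sem CS (con_subst CS \<sigma> c) = con_sem CS (con_subst CS \<tau> c)"
  by (rule con_sem_eq_if_nf_eq) (auto simp: con_nf_subst intro: con_nf_cong)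

lemma con_sem_subst_comp:
  "con_sem CS (con_subst CS \<tau> (con_subst CS \<sigma> c)) = con_sem CS (con_subst CS (\<tau> \<circ> \<sigma>) c)"
  by (rule con_sem_eq_if_nf_eq) (simp add: con_nf_subst comp_assoc)

lemma con_sem_subst_mono_single:
  assumes "con_sem CS c \<le> con_sem CS d"
  shows "con_sem CS (con_subst CS (id(x := y)) c) \<le> con_sem CS (con_subst CS (id(x := y)) d)"
proof (cases "x = y")
  case True
  then show ?thesis using assms by simp
next
  case False
  then show ?thesis using assms by (simp add: con_sem_subst_single ex_mono le_supI1)
qed

text \<open>Since no value of \<open>\<sigma>\<close> on \<open>V\<close> lies in \<open>V\<close>,
  single renamings performed one after another do not interfere, and their composition is
  \<open>\<sigma>\<close>. Each of them is monotone.\<close>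

lemma con_sem_subst_mono_disjoint:
  assumes "finite V" "con_sem CS c \<le> con_sem CS d"
    and "\<sigma> ` V \<inter> V = {}" "\<And>x. x \<notin> V \<Longrightarrow> \<sigma> x = x"
  shows "con_sem CS (con_subst CS \<sigma> c) \<le> con_sem CS (con_subst CS \<sigma> d)"
  using assms(1,3,4)
proof (induction V arbitrary: \<sigma> rule: finite_induct)
  case empty
  then have "\<sigma> = id" by auto
  then show "con_sem CS (con_subst CS \<sigma> c) \<le> con_sem CS (con_subst CS \<sigma> d)"
    using assms(2) by simp
next
  case (insert v V)
  let ?\<tau> = "\<sigma>(v := v)"
  have "con_sem CS (con_subst CS ?\<tau> c) \<le> con_sem CS (con_subst CS ?\<tau> d)"
    by (rule insert.IH) (use insert.prems insert.hyps in \<open>auto split: if_splits\<close>)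
  then have "con_sem CS (con_subst CS (id(v := \<sigma> v)) (con_subst CS ?\<tau> c)) \<le>
      con_sem CS (con_subst CS (id(v := \<sigma> v)) (con_subst CS ?\<tau> d))"
    by (rule con_sem_subst_mono_single)
  moreover have "id(v := \<sigma> v) \<circ> ?\<tau> = \<sigma>"
  proof
    fix x
    show "(id(v := \<sigma> v) \<circ> ?\<tau>) x = \<sigma> x"
      using insert.prems insert.hyps by (cases "x \<in> V") auto
  qed
  ultimately show ?case by (simp only: con_sem_subst_comp)
qed

lemma ex_fresh_injection:
  fixes V F :: "'v set"
  assumes "finite V" "finite F"
  shows "\<exists>u. inj_on u V \<and> u ` V \<inter> F = {}"
proof -
  have "infinite (- F)" using assms by (simp add: finite_compl infinite_UNIV)
  then obtain B where B: "finite B" "card B = card V" "B \<subseteq> - F"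
    using infinite_arbitrarily_large by blast
  then obtain u where "bij_betw u V B"
    using assms by (metis finite_same_card_bij)
  then show ?thesis using B(3) by (auto simp: bij_betw_def)
qed

text \<open>An arbitrary substitution acts on finitely many variables like a composition of two
  substitutions with disjoint domain and range, passing through fresh variables.\<close>

lemma con_sem_subst_mono:
  assumes "con_sem CS c \<le> con_sem CS d"
  shows "con_sem CS (con_subst CS \<sigma> c) \<le> con_sem CS (con_subst CS \<sigma> d)"
proof -
  define V where "V = con_fv CS c \<union> con_fv CS d"
  have V: "finite V" by (simp add: V_def)
  obtain u where u: "inj_on u V" "u ` V \<inter> (V \<union> \<sigma> ` V) = {}"
    using ex_fresh_injection[of V "V \<union> \<sigma> ` V"] V by auto
  define \<alpha> where "\<alpha> x = (if x \<in> V then u x else x)" for x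
  define \<beta> where "\<beta> x = (if x \<in> u ` V then \<sigma> (the_inv_into V u x) else x)" for x
  have "con_sem CS (con_subst CS \<alpha> c) \<le> con_sem CS (con_subst CS \<alpha> d)"
    by (rule con_sem_subst_mono_disjoint[OF V assms]) (use u in \<open>auto simp: \<alpha>_def\<close>)
  then have "con_sem CS (con_subst CS \<beta> (con_subst CS \<alpha> c)) \<le>
      con_sem CS (con_subst CS \<beta> (con_subst CS \<alpha> d))"
  proof (rule con_sem_subst_mono_disjoint[rotated])
    have "\<beta> ` u ` V \<subseteq> \<sigma> ` V" using u by (auto simp: \<beta>_def the_inv_into_f_f)
    then show "\<beta> ` u ` V \<inter> u ` V = {}" using u by blast
  qed (use V in \<open>auto simp: \<beta>_def\<close>)
  moreover have "(\<beta> \<circ> \<alpha>) x = \<sigma> x" if "x \<in> V" for x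
    using that u by (simp add: \<alpha>_def \<beta>_def the_inv_into_f_f)
  then have "con_sem CS (con_subst CS (\<beta> \<circ> \<alpha>) c) = con_sem CS (con_subst CS \<sigma> c)"
    "con_sem CS (con_subst CS (\<beta> \<circ> \<alpha>) d) = con_sem CS (con_subst CS \<sigma> d)"
    by (auto intro!: con_sem_subst_cong simp: V_def)
  ultimately show ?thesis by (simp only: con_sem_subst_comp)
qed

section \<open>Hiding finite sets of variables, and prenex forms of constraints\<close>

lemma ex_set_empty [simp]: "ex_set CS {} e = e"
  by (simp add: ex_set_def)

lemma ex_set_insert [simp]:
  assumes "finite A"
  shows "ex_set CS (insert x A) e = ex CS x (ex_set CS A e)"
proof -
  interpret comp_fun_idem "ex CS"
    \<comment> \<open>Commutation makes the fold independent of the order; idempotence covers the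
      case that \<open>x\<close> already lies in \<open>A\<close>.\<close>
    by unfold_locales (auto simp: fun_eq_iff ex_commute)
  show ?thesis using assms by (simp add: ex_set_def fold_insert_idem)
qed

lemma ex_set_union: "finite A \<Longrightarrow> finite B \<Longrightarrow> ex_set CS (A \<union> B) e = ex_set CS A (ex_set CS B e)"
  by (induction A rule: finite_induct) auto

lemma ex_set_le: "finite A \<Longrightarrow> ex_set CS A e \<le> e"
  by (induction A rule: finite_induct) (auto intro: order_trans ex_le)

lemma ex_set_mono: "finite A \<Longrightarrow> e \<le> e' \<Longrightarrow> ex_set CS A e \<le> ex_set CS A e'"
  by (induction A rule: finite_induct) (auto intro: ex_mono)

lemma ex_set_sup_closed:
  "finite A \<Longrightarrow> (\<And>x. x \<in> A \<Longrightarrow> ex CS x b = b) \<Longrightarrow> ex_set CS A (sup a b) = sup (ex_set CS A a) b"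
  by (induction A rule: finite_induct) (auto simp: ex_sup_closed)

lemma ex_set_closed: "finite A \<Longrightarrow> (\<And>x. x \<in> A \<Longrightarrow> ex CS x b = b) \<Longrightarrow> ex_set CS A b = b"
  by (induction A rule: finite_induct) auto

lemma store_sem_union: "store_sem CS (S \<union> S') = sup (store_sem CS S) (store_sem CS S')"
  by (simp add: store_sem_def SUP_union)

lemma ex_store_sem:
  assumes "finite S" "x \<notin> store_fv CS S"
  shows "ex CS x (store_sem CS S) = store_sem CS S"
  using assms
proof (induction S rule: finite_induct)
  case empty
  then show ?case by (simp add: store_sem_def)
next
  case (insert c S)
  then have "ex CS x (con_sem CS c) = con_sem CS c" "ex CS x (store_sem CS S) = store_sem CS S"
    by (auto simp: store_fv_def intro: ex_con_sem)
  moreover have "store_sem CS (insert c S) = sup (con_sem CS c) (store_sem CS S)"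
    by (simp add: store_sem_def)
  ultimately show ?case by (simp add: ex_sup_closed)
qed

text \<open>Quantifiers can all be moved to the front when no binder is repeated or also occurs
  free: in a conjunction, the binders of one side then do not occur in the other.\<close>

lemma con_sem_prenex:
  "distinct (con_binders c) \<Longrightarrow> con_bv c \<inter> con_fv CS c = {} \<Longrightarrow>
    con_sem CS c = ex_set CS (con_bv c) (store_sem CS (basic c))"
proof (induction c)
  case (Conj c d)
  have c: "con_sem CS c = ex_set CS (con_bv c) (store_sem CS (basic c))"
    by (rule Conj.IH) (use Conj.prems in \<open>auto simp: con_bv_def\<close>)
  have d: "con_sem CS d = ex_set CS (con_bv d) (store_sem CS (basic d))"
    by (rule Conj.IH) (use Conj.prems in \<open>auto simp: con_bv_def\<close>)
  \<comment> \<open>The variables of the atoms of \<open>c\<close> are free variables or binders of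
    \<open>c\<close>, and a binder of \<open>d\<close> is neither.\<close>
  have "ex CS x (store_sem CS (basic c)) = store_sem CS (basic c)" if "x \<in> con_bv d" for x
    using that Conj.prems fv_basic_le[of c] by (intro ex_store_sem) (auto simp: con_bv_def)
  then have "ex_set CS (con_bv d) (sup (store_sem CS (basic d)) (store_sem CS (basic c))) =
      sup (con_sem CS d) (store_sem CS (basic c))"
    by (simp add: ex_set_sup_closed d)
  moreover have "ex CS x (con_sem CS d) = con_sem CS d" if "x \<in> con_bv c" for x
    using that Conj.prems by (intro ex_con_sem) (auto simp: con_bv_def)
  then have "ex_set CS (con_bv c) (sup (store_sem CS (basic c)) (con_sem CS d)) =
      sup (con_sem CS c) (con_sem CS d)"
    by (simp add: ex_set_sup_closed c)
  moreover have "con_bv (Conj c d) = con_bv c \<union> con_bv d" by (simp add: con_bv_def)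
  ultimately show ?case by (simp add: ex_set_union store_sem_union sup_commute)
next
  case (Exi x c)
  have "con_sem CS c = ex_set CS (con_bv c) (store_sem CS (basic c))"
    by (rule Exi.IH) (use Exi.prems in \<open>auto simp: con_bv_def\<close>)
  moreover have "con_bv (Exi x c) = insert x (con_bv c)" by (simp add: con_bv_def)
  ultimately show ?case by simp
qed (auto simp: con_bv_def store_sem_def)

text \<open>The effect of telling \<open>c\<close> on a store with \<open>Y\<close> hidden: the new
  binders \<open>B\<close> are fresh for \<open>S\<close>, so hiding them affects only the atoms of
  \<open>c\<close>, and \<open>Y\<close> misses \<open>c\<close>, so hiding it affects only
  \<open>S\<close>.\<close>

lemma atoms_store:
  assumes "(B, T) \<in> atoms CS c (fvars CS X S \<Gamma> \<Gamma>')" "finite S" "finite Y" "Y \<inter> con_fv CS c = {}"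
  shows "ex_set CS (Y \<union> B) (store_sem CS (S \<union> T)) = sup (con_sem CS c) (ex_set CS Y (store_sem CS S))"
    and "finite B" "finite T" "con_fv CS c \<subseteq> store_fv CS T"
    and "B \<inter> (X \<union> store_fv CS S \<union> tagged_fv CS (\<Gamma> @ \<Gamma>')) = {}"
proof -
  obtain c' where c': "con_alpha CS c c'" "distinct (con_binders c')" "con_bv c' \<inter> con_fv CS c = {}"
      and fresh: "con_bv c' \<inter> fvars CS X S \<Gamma> \<Gamma>' = {}" and B: "B = con_bv c'" and T: "T = basic c'"
    using assms(1) by (auto simp: atoms_def)
  have "con_sem CS c = con_sem CS c'" by (rule con_sem_alpha) (rule c')
  also have "\<dots> = ex_set CS B (store_sem CS T)"
    using c' con_alpha_fv[OF c'(1)] by (simp add: con_sem_prenex B T)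
  finally have c: "con_sem CS c = ex_set CS B (store_sem CS T)" .
  show fin: "finite B" "finite T" by (simp_all add: B T)
  show "con_fv CS c \<subseteq> store_fv CS T"
    using con_alpha_fv[OF c'(1)] fv_le_basic[of c'] by (simp add: T)
  show fr: "B \<inter> (X \<union> store_fv CS S \<union> tagged_fv CS (\<Gamma> @ \<Gamma>')) = {}"
    using fresh by (auto simp: B fvars_def tagged_fv_def)
  have "ex_set CS (Y \<union> B) (store_sem CS (S \<union> T)) =
      ex_set CS Y (ex_set CS B (sup (store_sem CS T) (store_sem CS S)))"
    using assms fin by (simp add: ex_set_union store_sem_union sup_commute[of "store_sem CS S"])
  also have "ex_set CS B (sup (store_sem CS T) (store_sem CS S)) = sup (con_sem CS c) (store_sem CS S)"
    unfolding c using fr assms(2) fin by (intro ex_set_sup_closed ex_store_sem) auto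
  also have "\<dots> = sup (store_sem CS S) (con_sem CS c)" by (rule sup_commute)
  also have "ex_set CS Y \<dots> = sup (ex_set CS Y (store_sem CS S)) (con_sem CS c)"
    using assms by (intro ex_set_sup_closed ex_con_sem) auto
  also have "\<dots> = sup (con_sem CS c) (ex_set CS Y (store_sem CS S))" by (rule sup_commute)
  finally show "ex_set CS (Y \<union> B) (store_sem CS (S \<union> T)) =
      sup (con_sem CS c) (ex_set CS Y (store_sem CS S))" .
qed

section \<open>Multisets of processes\<close>

lemma par_list_simps [simp]: "par_list [] = Skip" "par_list (P # Ps) = Par P (par_list Ps)"
  by (simp_all add: par_list_def)

lemma par_list_append: "proc_cong CS (par_list (Ps @ Qs)) (Par (par_list Ps) (par_list Qs))"
proof (induction Ps)
  case Nil
  show ?case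
    using proc_cong.sym[OF proc_cong.trans[OF proc_cong.par_comm proc_cong.par_skip]] by simp
next
  case (Cons P Ps)
  have "proc_cong CS (par_list ((P # Ps) @ Qs)) (Par P (Par (par_list Ps) (par_list Qs)))"
    using Cons by (auto intro: proc_cong.par proc_cong.refl)
  then show ?case
    using proc_cong.par_assoc proc_cong.trans by fastforce
qed

lemma par_list_context:
  assumes "proc_cong CS (par_list Ps) (par_list Qs)"
  shows "proc_cong CS (par_list (Rs @ Ps @ Rs')) (par_list (Rs @ Qs @ Rs'))"
proof -
  have "proc_cong CS (par_list (Rs @ Ps @ Rs')) (Par (par_list Rs) (Par (par_list Ps) (par_list Rs')))"
    for Ps by (meson par_list_append proc_cong.par proc_cong.refl proc_cong.trans)
  note * = this
  have "proc_cong CS (Par (par_list Rs) (Par (par_list Ps) (par_list Rs')))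
      (Par (par_list Rs) (Par (par_list Qs) (par_list Rs')))"
    using assms by (intro proc_cong.par proc_cong.refl)
  then show ?thesis
    using *[of Ps] *[of Qs] by (meson proc_cong.sym proc_cong.trans)
qed

text \<open>Once the identifiers are erased, a split is an instance of associativity.\<close>

lemma par_split_proc_cong:
  assumes "par_split \<Gamma> \<Gamma>'"
  shows "proc_cong CS (par_list (map fst \<Gamma>)) (par_list (map fst \<Gamma>'))"
  using assms
proof cases
  case (1 i j k \<Delta> \<Delta>' P Q)
  have "proc_cong CS (par_list [Par P Q]) (par_list [P, Q])"
    using proc_cong.sym[OF proc_cong.par_assoc] by simp
  then show ?thesis using par_list_context[of "[Par P Q]" "[P, Q]"] 1 by simp
qed

lemma equivclp_par_split_proc_cong:
  assumes "equivclp par_split \<Gamma> \<Gamma>'"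
  shows "proc_cong CS (par_list (map fst \<Gamma>)) (par_list (map fst \<Gamma>'))"
  using assms
proof (induction rule: equivclp_induct)
  case base
  then show ?case by (rule proc_cong.refl)
next
  case (step \<Delta> \<Delta>')
  then have "proc_cong CS (par_list (map fst \<Delta>)) (par_list (map fst \<Delta>'))"
    using par_split_proc_cong proc_cong.sym by blast
  with step show ?case by (blast intro: proc_cong.trans)
qed

lemma mset_congI: "proc_cong CS (par_list Ps) (par_list Qs) \<Longrightarrow> mset_cong CS (mset Ps) (mset Qs)"
  by (auto simp: mset_cong_def)

text \<open>Absorbs the \<open>Skip\<close> that a standard tell leaves behind; the collecting tell
  deletes the process.\<close>

lemma mset_cong_Skip: "mset_cong CS (add_mset Skip (mset Ps)) (mset Ps)"
proof -
  have "proc_cong CS (Par Skip (par_list Ps)) (par_list Ps)"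
    by (rule proc_cong.trans[OF proc_cong.par_comm proc_cong.par_skip])
  then show ?thesis using mset_congI[of "Skip # Ps" Ps] by simp
qed

lemma mset_cong_add:
  "proc_cong CS P Q \<Longrightarrow> mset_cong CS (add_mset P (mset Ps)) (add_mset Q (mset Ps))"
  using mset_congI[of "P # Ps" "Q # Ps"] by (simp add: proc_cong.par proc_cong.refl)

lemma mset_cong_refl: "mset_cong CS \<Gamma> \<Gamma>"
  by (metis ex_mset mset_congI proc_cong.refl)

lemma mset_fv_par_list: "mset_fv CS (mset Ps) = proc_fv CS (par_list Ps)"
  by (induction Ps) (auto simp: mset_fv_def)

lemma mset_cong_fv: "mset_cong CS \<Gamma> \<Gamma>' \<Longrightarrow> mset_fv CS \<Gamma> = mset_fv CS \<Gamma>'"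
  by (auto simp: mset_cong_def mset_fv_par_list proc_cong_fv)

lemma mset_fv_simps [simp]:
  "mset_fv CS {#} = {}"
  "mset_fv CS (add_mset P \<Gamma>) = proc_fv CS P \<union> mset_fv CS \<Gamma>"
  "mset_fv CS (\<Gamma> + \<Gamma>') = mset_fv CS \<Gamma> \<union> mset_fv CS \<Gamma>'"
  by (auto simp: mset_fv_def)

lemma finite_mset_fv [simp]: "finite (mset_fv CS \<Gamma>)"
  by (simp add: mset_fv_def)

lemma tagged_fv_eq: "tagged_fv CS \<Gamma> = mset_fv CS (mset (map fst \<Gamma>))"
  by (force simp: tagged_fv_def mset_fv_def)

text \<open>Free variables of a defined body are formal parameters, so unfolding a call cannot
  introduce a variable that is absent from the call. Hidden variables that miss the process keep
  missing it.\<close>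

lemma proc_fv_call:
  assumes "wf_defs CS D" "(p, ys, P) \<in> D" "length xs = length ys"
  shows "proc_fv CS (proc_subst CS (param_subst ys xs) P) \<subseteq> set xs"
proof -
  have "param_subst ys xs y \<in> set xs" if y: "y \<in> set ys" for y
  proof -
    have "map_of (zip ys xs) y \<noteq> None" using y assms(3) by simp
    then obtain x where x: "map_of (zip ys xs) y = Some x" by auto
    then have "x \<in> set xs" by (metis map_of_SomeD set_zip_rightD)
    then show ?thesis using x by (simp add: param_subst_def)
  qed
  moreover have "proc_fv CS P \<subseteq> set ys" using assms(1,2) by (fastforce simp: wf_defs_def)
  ultimately show ?thesis by (auto simp: proc_fv_subst)
qed

end

section \<open>From the collecting to the standard semantics\<close>

text \<open>\<open>X\<close> comes from local declarations and \<open>Y\<close> from told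
  constraints. By the last conjunct, a variable fresh for the collecting store is fresh for the
  standard one, as opening a local variable requires.\<close>

fun coll_std_rel :: "('v, 'a, 'c::complete_lattice) csystem \<Rightarrow> ('v, 'a, 'p) coll_config \<Rightarrow>
    ('v, 'a, 'p) std_config \<Rightarrow> bool" where
  "coll_std_rel CS (X', \<Gamma>', S) (X, \<Gamma>, d) \<longleftrightarrow>
     (\<exists>Y. finite X \<and> finite Y \<and> finite S \<and> X' = X \<union> Y \<and> \<Gamma> = mset (map fst \<Gamma>') \<and>
        Y \<inter> mset_fv CS \<Gamma> = {} \<and> con_sem CS d = ex_set CS Y (store_sem CS S) \<and>
        con_fv CS d \<subseteq> store_fv CS S)"

context constraint_language
begin

lemma std_cong_mset: "mset_cong CS \<Gamma> \<Gamma>' \<Longrightarrow> std_cong CS (X, \<Gamma>, d) (X, \<Gamma>', d)"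
  by (simp add: entails_def)

lemma std_cong_refl: "std_cong CS s s"
  by (cases s) (simp add: entails_def mset_cong_refl)

lemma coll_std_relE:
  assumes "coll_std_rel CS (X', \<Gamma> @ [(P, i)] @ \<Gamma>', S) s"
  obtains X d Y where "s = (X, add_mset P (mset (map fst (\<Gamma> @ \<Gamma>'))), d)" "X' = X \<union> Y"
    "finite X" "finite Y" "finite S"
    "Y \<inter> mset_fv CS (add_mset P (mset (map fst (\<Gamma> @ \<Gamma>')))) = {}"
    "con_sem CS d = ex_set CS Y (store_sem CS S)" "con_fv CS d \<subseteq> store_fv CS S"
proof -
  obtain X M d where s: "s = (X, M, d)" by (cases s)
  from assms obtain Y where Y: "finite X" "finite Y" "finite S" "X' = X \<union> Y"
      "M = mset (map fst (\<Gamma> @ [(P, i)] @ \<Gamma>'))" "Y \<inter> mset_fv CS M = {}"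
      "con_sem CS d = ex_set CS Y (store_sem CS S)" "con_fv CS d \<subseteq> store_fv CS S"
    unfolding s coll_std_rel.simps by blast
  have M: "M = add_mset P (mset (map fst (\<Gamma> @ \<Gamma>')))" using Y(5) by simp
  show ?thesis
    by (rule that[of X d Y]) (use Y(1-4,6-) s M in simp_all)
qed

text \<open>A tell enlarges \<open>Y\<close> by the binders of its atoms, a local declaration
  enlarges \<open>X\<close>, and the other rules keep both. Identifications of sequences become
  structural congruences.\<close>

lemma coll_step_std:
  assumes "coll_step CS D k k'" "wf_defs CS D" "coll_std_rel CS k s"
  shows "\<exists>s'. std_step CS D s s' \<and> coll_std_rel CS k' s'"
  using assms(1,3)
proof (induction arbitrary: s rule: coll_step.induct)
  case (tell B T c X' S \<Gamma> \<Gamma>' i)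
  let ?M = "mset (map fst (\<Gamma> @ \<Gamma>'))"
  from tell.prems obtain X d Y where s: "s = (X, add_mset (Tell c) ?M, d)"
    and Y: "X' = X \<union> Y" "finite X" "finite Y" "finite S"
      "Y \<inter> mset_fv CS (add_mset (Tell c) ?M) = {}"
      "con_sem CS d = ex_set CS Y (store_sem CS S)" "con_fv CS d \<subseteq> store_fv CS S"
    by (rule coll_std_relE) (rule that, assumption+)
  have "Y \<inter> con_fv CS c = {}" using Y by auto
  note B = atoms_store[OF tell.hyps Y(4,3) this]
  have "mset_cong CS (add_mset Skip ?M) ?M" by (rule mset_cong_Skip)
  then have "std_step CS D s (X, ?M, Conj c d)"
    unfolding s by (intro std_step.equiv[OF std_cong_refl std_step.tell] std_cong_mset)
  moreover have "coll_std_rel CS (X' \<union> B, \<Gamma> @ \<Gamma>', S \<union> T) (X, ?M, Conj c d)"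
    unfolding coll_std_rel.simps
  proof (intro exI[of _ "Y \<union> B"] conjI)
    show "(Y \<union> B) \<inter> mset_fv CS ?M = {}" using Y B(5) by (auto simp: tagged_fv_eq)
    show "con_sem CS (Conj c d) = ex_set CS (Y \<union> B) (store_sem CS (S \<union> T))"
      using B(1) Y(6) by simp
    show "con_fv CS (Conj c d) \<subseteq> store_fv CS (S \<union> T)"
      using B(4) Y(7) by (auto simp: store_fv_def)
  qed (use Y B in auto)
  ultimately show ?case by blast
next
  case (sum c P bs S j \<Gamma> i \<Gamma>' X')
  let ?M = "mset (map fst (\<Gamma> @ \<Gamma>'))"
  from sum.prems obtain X d Y where s: "s = (X, add_mset (Sum bs) ?M, d)"
    and Y: "X' = X \<union> Y" "finite X" "finite Y" "finite S"
      "Y \<inter> mset_fv CS (add_mset (Sum bs) ?M) = {}"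
      "con_sem CS d = ex_set CS Y (store_sem CS S)" "con_fv CS d \<subseteq> store_fv CS S"
    by (rule coll_std_relE) (rule that, assumption+)
  have fv: "con_fv CS c \<union> proc_fv CS P \<subseteq> proc_fv CS (Sum bs)"
    using sum.hyps(1) by (auto intro!: bexI[of _ "(c, P)"])
  then have "Y \<inter> con_fv CS c = {}" using Y by auto
  \<comment> \<open>Hiding \<open>Y\<close> leaves the guard unchanged, so by monotonicity the
    weaker standard store still entails it.\<close>
  then have "ex_set CS Y (con_sem CS c) = con_sem CS c"
    using Y(3) by (intro ex_set_closed ex_con_sem) auto
  then have "entails (con_sem CS d) (con_sem CS c)"
    using sum.hyps(2) Y ex_set_mono by (metis entails_def)
  then have "std_step CS D s (X, add_mset P ?M, d)"
    unfolding s by (rule std_step.sum[OF sum.hyps(1)])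
  moreover have "coll_std_rel CS (X', \<Gamma> @ [(P, j)] @ \<Gamma>', S) (X, add_mset P ?M, d)"
    using Y fv by (auto intro!: exI[of _ Y])
  ultimately show ?case by blast
next
  case (local x' X' S \<Gamma> \<Gamma>' x P j i)
  let ?M = "mset (map fst (\<Gamma> @ \<Gamma>'))" and ?P = "proc_subst CS (id(x := x')) P"
  from local.prems obtain X d Y where s: "s = (X, add_mset (Local x P) ?M, d)"
    and Y: "X' = X \<union> Y" "finite X" "finite Y" "finite S"
      "Y \<inter> mset_fv CS (add_mset (Local x P) ?M) = {}"
      "con_sem CS d = ex_set CS Y (store_sem CS S)" "con_fv CS d \<subseteq> store_fv CS S"
    by (rule coll_std_relE) (rule that, assumption+)
  have x': "x' \<notin> X \<union> Y \<union> con_fv CS d \<union> mset_fv CS ?M"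
    using local.hyps(1) Y by (auto simp: fvars_def tagged_fv_eq)
  have "proc_cong CS (Local x P) (Local x' ?P)"
  \<comment> \<open>The standard process is first converted to the name chosen by the collecting
    rule. If that name is \<open>x\<close> itself, it may be free in the body, and nothing has to be
    converted.\<close>
  proof (cases "x' = x")
    case True
    then show ?thesis by (simp add: proc_cong.refl)
  next
    case False
    then show ?thesis using local.hyps(2) by (intro proc_cong.alpha) auto
  qed
  then have "mset_cong CS (add_mset (Local x P) ?M) (add_mset (Local x' ?P) ?M)"
    by (rule mset_cong_add)
  then have "std_step CS D s (X \<union> {x'}, add_mset ?P ?M, d)"
    unfolding s using x'
    by (intro std_step.equiv[OF std_cong_mset std_step.local std_cong_refl]) auto
  moreover have "coll_std_rel CS (X' \<union> {x'}, \<Gamma> @ [(?P, j)] @ \<Gamma>', S) (X \<union> {x'}, add_mset ?P ?M, d)"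
    unfolding coll_std_rel.simps
  proof (intro exI[of _ Y] conjI)
    have "proc_fv CS ?P \<subseteq> insert x' (proc_fv CS (Local x P))" by (auto simp: proc_fv_subst)
    then show "Y \<inter> mset_fv CS (add_mset ?P ?M) = {}"
      using x' Y(5) unfolding mset_fv_simps by blast
  qed (use Y in auto)
  ultimately show ?case by blast
next
  case (call p ys P xs j \<Gamma> i \<Gamma>' X' S)
  let ?M = "mset (map fst (\<Gamma> @ \<Gamma>'))" and ?P = "proc_subst CS (param_subst ys xs) P"
  from call.prems obtain X d Y where s: "s = (X, add_mset (Call p xs) ?M, d)"
    and Y: "X' = X \<union> Y" "finite X" "finite Y" "finite S"
      "Y \<inter> mset_fv CS (add_mset (Call p xs) ?M) = {}"
      "con_sem CS d = ex_set CS Y (store_sem CS S)" "con_fv CS d \<subseteq> store_fv CS S"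
    by (rule coll_std_relE) (rule that, assumption+)
  have "std_step CS D s (X, add_mset ?P ?M, d)"
    unfolding s by (rule std_step.call[OF call.hyps(1,2)])
  moreover have "coll_std_rel CS (X', \<Gamma> @ [(?P, j)] @ \<Gamma>', S) (X, add_mset ?P ?M, d)"
    using Y proc_fv_call[OF assms(2) call.hyps(1,2)] by (auto intro!: exI[of _ Y])
  ultimately show ?case by blast
next
  case (ident k1 k2 k2' k1')
  obtain X1 \<Gamma>1 S1 where k1: "k1 = (X1, \<Gamma>1, S1)" by (cases k1) auto
  with ident.hyps(1) obtain \<Gamma>2 where k2: "k2 = (X1, \<Gamma>2, S1)" "equivclp par_split \<Gamma>1 \<Gamma>2"
    by (cases k2) auto
  obtain X2 \<Gamma>3 S2 where k2': "k2' = (X2, \<Gamma>3, S2)" by (cases k2') auto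
  with ident.hyps(3) obtain \<Gamma>4 where k1': "k1' = (X2, \<Gamma>4, S2)" "equivclp par_split \<Gamma>3 \<Gamma>4"
    by (cases k1') auto
  obtain X M d where s: "s = (X, M, d)" by (cases s) auto
  have M: "M = mset (map fst \<Gamma>1)" using ident.prems s k1 by auto
  have c12: "mset_cong CS M (mset (map fst \<Gamma>2))"
    unfolding M by (rule mset_congI[OF equivclp_par_split_proc_cong[OF k2(2)]])
  have "coll_std_rel CS k2 (X, mset (map fst \<Gamma>2), d)"
    using ident.prems mset_cong_fv[OF c12] s k1 k2(1) by auto
  then obtain s' where s': "std_step CS D (X, mset (map fst \<Gamma>2), d) s'" "coll_std_rel CS k2' s'"
    using ident.IH by blast
  obtain X' d' where s'_eq: "s' = (X', mset (map fst \<Gamma>3), d')"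
    using s'(2) k2' by (cases s') auto
  have c34: "mset_cong CS (mset (map fst \<Gamma>3)) (mset (map fst \<Gamma>4))"
    by (rule mset_congI[OF equivclp_par_split_proc_cong[OF k1'(2)]])
  have "std_step CS D s (X', mset (map fst \<Gamma>4), d')"
    unfolding s
    by (rule std_step.equiv[OF std_cong_mset[OF c12] s'(1)[unfolded s'_eq] std_cong_mset[OF c34]])
  moreover have "coll_std_rel CS k1' (X', mset (map fst \<Gamma>4), d')"
    using s'(2) mset_cong_fv[OF c34] s'_eq k2' k1'(1) by auto
  ultimately show ?case by blast
qed

lemma coll_steps_std:
  assumes "(coll_step CS D)\<^sup>*\<^sup>* k k'" "wf_defs CS D" "coll_std_rel CS k s"
  shows "\<exists>s'. (std_step CS D)\<^sup>*\<^sup>* s s' \<and> coll_std_rel CS k' s'"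
  using assms(1,3)
proof (induction rule: rtranclp_induct)
  case (step k1 k2)
  then show ?case using coll_step_std[OF step.hyps(2) assms(2)] by (meson rtranclp.simps)
qed blast

end

section \<open>From the standard to the collecting semantics\<close>

definition mset_nf :: "('v, 'a, 'c) csystem \<Rightarrow> ('v \<Rightarrow> 'v) \<Rightarrow> ('v, 'a, 'p) proc multiset \<Rightarrow>
    ('v, 'a, 'p) proc_form multiset" where
  "mset_nf CS \<sigma> \<Gamma> = (\<Sum>P\<in>#\<Gamma>. proc_nf CS P \<sigma>)"

text \<open>In such a sequence every process contributes at most one form, so a form can be traced
  back to a single process.\<close>

definition no_par :: "('v, 'a, 'p) tagged \<Rightarrow> bool" where
  "no_par \<Gamma> \<longleftrightarrow> (\<forall>P Q i. (Par P Q, i) \<notin> set \<Gamma>)"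

text \<open>\<open>\<rho>\<close> renames the hidden variables of the standard configuration to those of the collecting
  one, and \<open>Y\<close> contains the remaining hidden variables of the latter, which are bound in the
  standard store.  As the standard semantics may choose a hidden variable that the collecting store
  mentions without depending on it, the two cannot always be taken equal.  The last conjunct is
  stated semantically because replacing the store by an equivalent one may introduce variables.\<close>

definition renaming_rel :: "('v, 'a, 'c::complete_lattice) csystem \<Rightarrow> ('v \<Rightarrow> 'v) \<Rightarrow> 'v set \<Rightarrow>
    ('v, 'a, 'p) std_config \<Rightarrow> ('v, 'a, 'p) coll_config \<Rightarrow> bool" where
  "renaming_rel CS \<rho> Y s k \<longleftrightarrow> (case (s, k) of ((X, \<Gamma>, d), (X', \<Gamma>', S)) \<Rightarrow>
     finite X \<and> finite Y \<and> finite S \<and> distinct (map snd \<Gamma>') \<and>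
     X' = \<rho> ` X \<union> Y \<and> inj_on \<rho> X \<and> (\<forall>v. v \<notin> X \<longrightarrow> \<rho> v = v) \<and>
     Y \<inter> tagged_fv CS \<Gamma>' = {} \<and> mset_nf CS \<rho> \<Gamma> = mset_nf CS id (mset (map fst \<Gamma>')) \<and>
     ex_set CS Y (store_sem CS S) = con_sem CS (con_subst CS \<rho> d) \<and>
     (\<forall>v\<in>\<rho> ` X - X. ex CS v (con_sem CS d) = con_sem CS d \<and> v \<notin> mset_fv CS \<Gamma>))"

lemma renaming_relD:
  assumes "renaming_rel CS \<rho> Y (X, \<Gamma>, d) (X', \<Gamma>', S)"
  shows "finite X" "finite Y" "finite S" "distinct (map snd \<Gamma>')" "X' = \<rho> ` X \<union> Y" "inj_on \<rho> X"
    "\<And>v. v \<notin> X \<Longrightarrow> \<rho> v = v" "Y \<inter> tagged_fv CS \<Gamma>' = {}"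
    "mset_nf CS \<rho> \<Gamma> = mset_nf CS id (mset (map fst \<Gamma>'))"
    "ex_set CS Y (store_sem CS S) = con_sem CS (con_subst CS \<rho> d)"
    "\<And>v. v \<in> \<rho> ` X - X \<Longrightarrow> ex CS v (con_sem CS d) = con_sem CS d"
    "\<And>v. v \<in> \<rho> ` X - X \<Longrightarrow> v \<notin> mset_fv CS \<Gamma>"
  using assms by (simp_all add: renaming_rel_def)

lemma renaming_relI:
  assumes "finite X" "finite Y" "finite S" "distinct (map snd \<Gamma>')" "X' = \<rho> ` X \<union> Y" "inj_on \<rho> X"
    "\<And>v. v \<notin> X \<Longrightarrow> \<rho> v = v" "Y \<inter> tagged_fv CS \<Gamma>' = {}"
    "mset_nf CS \<rho> \<Gamma> = mset_nf CS id (mset (map fst \<Gamma>'))"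
    "ex_set CS Y (store_sem CS S) = con_sem CS (con_subst CS \<rho> d)"
    "\<And>v. v \<in> \<rho> ` X - X \<Longrightarrow> ex CS v (con_sem CS d) = con_sem CS d"
    "\<And>v. v \<in> \<rho> ` X - X \<Longrightarrow> v \<notin> mset_fv CS \<Gamma>"
  shows "renaming_rel CS \<rho> Y (X, \<Gamma>, d) (X', \<Gamma>', S)"
  using assms by (simp add: renaming_rel_def)

lemma mset_nf_simps [simp]:
  "mset_nf CS \<sigma> {#} = {#}"
  "mset_nf CS \<sigma> (add_mset P \<Gamma>) = proc_nf CS P \<sigma> + mset_nf CS \<sigma> \<Gamma>"
  "mset_nf CS \<sigma> (\<Gamma> + \<Gamma>') = mset_nf CS \<sigma> \<Gamma> + mset_nf CS \<sigma> \<Gamma>'"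
  by (simp_all add: mset_nf_def)

lemma mset_nf_par_list: "mset_nf CS \<sigma> (mset Ps) = proc_nf CS (par_list Ps) \<sigma>"
  by (induction Ps) (simp_all add: par_list_def)

text \<open>Each split removes one \<open>Par\<close>, so the total size of the processes decreases;
  identifiers for the two parts are always available.\<close>

lemma par_split_exhaust:
  "distinct (map snd \<Gamma>) \<Longrightarrow>
    \<exists>\<Gamma>'. equivclp par_split \<Gamma> \<Gamma>' \<and> distinct (map snd \<Gamma>') \<and> no_par \<Gamma>'"
proof (induction "sum_list (map (size \<circ> fst) \<Gamma>)" arbitrary: \<Gamma> rule: less_induct)
  case less
  show ?case
  proof (cases "no_par \<Gamma>")
    case True
    then show ?thesis using less.prems by (auto intro!: exI[of _ \<Gamma>])
  next
    case False
    then obtain P Q i where "(Par P Q, i) \<in> set \<Gamma>" by (auto simp: no_par_def)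
    then obtain \<Delta> \<Delta>' where \<Gamma>: "\<Gamma> = \<Delta> @ [(Par P Q, i)] @ \<Delta>'" by (auto dest: split_list)
    obtain j where j: "j \<notin> set (map snd \<Gamma>)"
      using ex_new_if_finite[OF infinite_UNIV_nat, of "set (map snd \<Gamma>)"] by blast
    obtain k where k: "k \<notin> insert j (set (map snd \<Gamma>))"
      using ex_new_if_finite[OF infinite_UNIV_nat, of "insert j (set (map snd \<Gamma>))"] by blast
    let ?\<Gamma> = "\<Delta> @ [(P, j), (Q, k)] @ \<Delta>'"
    have "par_split \<Gamma> ?\<Gamma>"
      unfolding \<Gamma> by (rule par_split.intros) (use less.prems j k \<Gamma> in auto)
    then have split: "equivclp par_split \<Gamma> ?\<Gamma>" by blast
    have "\<exists>\<Gamma>'. equivclp par_split ?\<Gamma> \<Gamma>' \<and> distinct (map snd \<Gamma>') \<and> no_par \<Gamma>'"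
      by (rule less.hyps) (use less.prems j k \<Gamma> in auto)
    then show ?thesis using split by (meson equivclp_trans)
  qed
qed

context constraint_language
begin

section \<open>Invariance of the relation and location of the active process\<close>

lemma mset_cong_nf: "mset_cong CS \<Gamma> \<Gamma>' \<Longrightarrow> mset_nf CS \<sigma> \<Gamma> = mset_nf CS \<sigma> \<Gamma>'"
  by (auto simp: mset_cong_def mset_nf_par_list proc_nf_cong_eq)

lemma mset_nf_subst_cong:
  "(\<And>x. x \<in> mset_fv CS \<Gamma> \<Longrightarrow> \<sigma> x = \<tau> x) \<Longrightarrow> mset_nf CS \<sigma> \<Gamma> = mset_nf CS \<tau> \<Gamma>"
  unfolding mset_nf_def mset_fv_def
  by (intro arg_cong[where f = sum_mset] image_mset_cong proc_nf_cong) auto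

lemma ex_atoms:
  assumes "finite V"
  obtains B T where "(B, T) \<in> atoms CS c V"
proof -
  obtain c' where "con_alpha CS c c'" "distinct (con_binders c')" "con_bv c' \<inter> (con_fv CS c \<union> V) = {}"
    using ex_distinct_alpha[of "con_fv CS c \<union> V" c] assms by auto
  then have "(con_bv c', basic c') \<in> atoms CS c V" by (auto simp: atoms_def)
  then show ?thesis by (rule that)
qed

text \<open>The relation sees a standard configuration only through forms, free variables and
  meanings. Equivalent stores stay equivalent after renaming, by monotonicity of substitution in
  both directions.\<close>

lemma renaming_rel_std_cong:
  assumes "std_cong CS s s'" "renaming_rel CS \<rho> Y s k"
  shows "renaming_rel CS \<rho> Y s' k"
proof -
  obtain X \<Gamma> d where s: "s = (X, \<Gamma>, d)" by (cases s)
  obtain X' \<Gamma>' d' where s': "s' = (X', \<Gamma>', d')" by (cases s')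
  obtain Z \<Delta> S where k: "k = (Z, \<Delta>, S)" by (cases k)
  have cong: "X' = X" "mset_cong CS \<Gamma> \<Gamma>'" "con_sem CS d' = con_sem CS d"
    using assms(1) s s' by (auto simp: entails_def intro: order_antisym)
  have "con_sem CS (con_subst CS \<rho> d') = con_sem CS (con_subst CS \<rho> d)"
    using cong(3) by (intro order_antisym con_sem_subst_mono) simp_all
  then show ?thesis
    using assms(2) unfolding s s' k renaming_rel_def
    by (simp add: cong mset_cong_nf[OF cong(2)] mset_cong_fv[OF cong(2)])
qed

lemma renaming_rel_par_split:
  assumes "renaming_rel CS \<rho> Y s (X, \<Gamma>, S)" "equivclp par_split \<Gamma> \<Gamma>'" "distinct (map snd \<Gamma>')"
  shows "renaming_rel CS \<rho> Y s (X, \<Gamma>', S)"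
proof -
  have "mset_cong CS (mset (map fst \<Gamma>)) (mset (map fst \<Gamma>'))"
    by (rule mset_congI[OF equivclp_par_split_proc_cong[OF assms(2)]])
  note cong = mset_cong_nf[OF this] mset_cong_fv[OF this]
  obtain Z \<Delta> d where s: "s = (Z, \<Delta>, d)" by (cases s)
  show ?thesis
    using assms(1,3) cong unfolding s renaming_rel_def tagged_fv_eq by (simp del: mset_map)
qed

lemma mem_mset_nf: "f \<in># mset_nf CS \<sigma> (mset Ps) \<Longrightarrow> \<exists>P\<in>set Ps. f \<in># proc_nf CS P \<sigma>"
  by (induction Ps) auto

text \<open>Finds the collecting process that matches the one executed by the standard step. As it
  contributes only \<open>f\<close>, the rest of the sequence accounts for exactly
  \<open>N\<close>.\<close>

lemma mset_nf_focus:
  assumes "add_mset f N = mset_nf CS id (mset (map fst \<Gamma>))" "no_par \<Gamma>"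
  shows "\<exists>\<Gamma>\<^sub>1 P j \<Gamma>\<^sub>2. \<Gamma> = \<Gamma>\<^sub>1 @ [(P, j)] @ \<Gamma>\<^sub>2 \<and> (\<forall>Q R. P \<noteq> Par Q R) \<and>
    proc_nf CS P id = {#f#} \<and> N = mset_nf CS id (mset (map fst (\<Gamma>\<^sub>1 @ \<Gamma>\<^sub>2)))"
proof -
  have "f \<in># mset_nf CS id (mset (map fst \<Gamma>))"
    unfolding assms(1)[symmetric] by simp
  then obtain P where "P \<in> set (map fst \<Gamma>)" and f: "f \<in># proc_nf CS P id"
    using mem_mset_nf by blast
  then obtain j where Pj: "(P, j) \<in> set \<Gamma>" by auto
  then obtain \<Gamma>\<^sub>1 \<Gamma>\<^sub>2 where \<Gamma>: "\<Gamma> = \<Gamma>\<^sub>1 @ [(P, j)] @ \<Gamma>\<^sub>2" by (auto dest: split_list)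
  have P: "P \<noteq> Par Q R" for Q R using Pj assms(2) by (auto simp: no_par_def)
  then have "proc_nf CS P id = {#f#}" using f by (cases P) auto
  moreover from this have "N = mset_nf CS id (mset (map fst (\<Gamma>\<^sub>1 @ \<Gamma>\<^sub>2)))"
    using assms(1) unfolding \<Gamma> by simp
  ultimately show ?thesis using \<Gamma> P by blast
qed

lemma con_sem_renamed: "con_nf CS c' id = con_nf CS c \<rho> \<Longrightarrow> con_sem CS c' = con_sem CS (con_subst CS \<rho> c)"
  by (rule con_sem_eq_if_nf_eq) (simp add: con_nf_subst)

lemma param_subst_map:
  "y \<in> set ys \<Longrightarrow> length xs = length ys \<Longrightarrow> param_subst ys (map \<rho> xs) y = \<rho> (param_subst ys xs y)"
proof -
  assume y: "y \<in> set ys" "length xs = length ys"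
  then have "map_of (zip ys xs) y \<noteq> None" by simp
  then obtain x where "map_of (zip ys xs) y = Some x" by auto
  then show ?thesis by (simp add: param_subst_def zip_map2 map_of_map)
qed

lemma ex_fresh_id: "\<exists>j. j \<notin> ids \<Gamma>"
  using ex_new_if_finite[OF infinite_UNIV_nat, of "ids \<Gamma>"] by (simp add: ids_def)

lemma finite_tagged_fv [simp]: "finite (tagged_fv CS \<Gamma>)"
  by (simp add: tagged_fv_eq)

lemma finite_store_fv [simp]: "finite S \<Longrightarrow> finite (store_fv CS S)"
  by (simp add: store_fv_def)

lemma tagged_fv_simps [simp]:
  "tagged_fv CS [] = {}"
  "tagged_fv CS ((P, i) # \<Gamma>) = proc_fv CS P \<union> tagged_fv CS \<Gamma>"
  "tagged_fv CS (\<Gamma> @ \<Gamma>') = tagged_fv CS \<Gamma> \<union> tagged_fv CS \<Gamma>'"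
  by (auto simp: tagged_fv_def)

text \<open>Equal forms force the located process to have the same outermost constructor as the
  executed one, so the collecting rule of the same kind applies. The congruence rule changes the
  standard side alone, where the relation is invariant.\<close>

lemma std_step_coll_no_par:
  assumes "std_step CS D s s'" "wf_defs CS D" "renaming_rel CS \<rho> Y s (X', \<Gamma>', S)" "no_par \<Gamma>'"
  shows "\<exists>k' \<rho>' Y'. coll_step CS D (X', \<Gamma>', S) k' \<and> renaming_rel CS \<rho>' Y' s' k'"
  using assms(1,3)
proof (induction rule: std_step.induct)
  case (tell X c \<Gamma> d)
  note R = renaming_relD[OF tell]
  have "add_mset (PTell (con_nf CS c \<rho>)) (mset_nf CS \<rho> \<Gamma>) = mset_nf CS id (mset (map fst \<Gamma>'))"
    using R(9) by simp
  then obtain \<Gamma>\<^sub>1 P j \<Gamma>\<^sub>2 where \<Gamma>': "\<Gamma>' = \<Gamma>\<^sub>1 @ [(P, j)] @ \<Gamma>\<^sub>2" and "\<forall>Q R. P \<noteq> Par Q R"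
    and "proc_nf CS P id = {#PTell (con_nf CS c \<rho>)#}"
    and rest: "mset_nf CS \<rho> \<Gamma> = mset_nf CS id (mset (map fst (\<Gamma>\<^sub>1 @ \<Gamma>\<^sub>2)))"
    using mset_nf_focus[OF _ assms(4)] by blast
  then obtain c' where P: "P = Tell c'" and c': "con_nf CS c' id = con_nf CS c \<rho>"
    by (cases P) auto
  have "finite (fvars CS X' S \<Gamma>\<^sub>1 \<Gamma>\<^sub>2)" using R(1-3,5) by (simp add: fvars_def)
  then obtain B T where BT: "(B, T) \<in> atoms CS c' (fvars CS X' S \<Gamma>\<^sub>1 \<Gamma>\<^sub>2)" by (rule ex_atoms)
  have "Y \<inter> con_fv CS c' = {}" using R(8) unfolding \<Gamma>' P by auto
  note B = atoms_store[OF BT R(3,2) this]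
  have "coll_step CS D (X', \<Gamma>', S) (X' \<union> B, \<Gamma>\<^sub>1 @ \<Gamma>\<^sub>2, S \<union> T)"
    unfolding \<Gamma>' P by (rule coll_step.tell[OF BT])
  moreover have "renaming_rel CS \<rho> (Y \<union> B) (X, add_mset Skip \<Gamma>, Conj c d) (X' \<union> B, \<Gamma>\<^sub>1 @ \<Gamma>\<^sub>2, S \<union> T)"
  proof (rule renaming_relI)
    show "distinct (map snd (\<Gamma>\<^sub>1 @ \<Gamma>\<^sub>2))" using R(4) unfolding \<Gamma>' by auto
    show "(Y \<union> B) \<inter> tagged_fv CS (\<Gamma>\<^sub>1 @ \<Gamma>\<^sub>2) = {}" using R(8) B(5) unfolding \<Gamma>' by auto
    show "ex_set CS (Y \<union> B) (store_sem CS (S \<union> T)) = con_sem CS (con_subst CS \<rho> (Conj c d))"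
      using B(1) R(10) con_sem_renamed[OF c'] by simp
    \<comment> \<open>Such a \<open>v\<close> is not free in \<open>c\<close>, because
      \<open>Tell c\<close> belongs to the standard multiset.\<close>
    show "ex CS v (con_sem CS (Conj c d)) = con_sem CS (Conj c d)" if v: "v \<in> \<rho> ` X - X" for v
      using R(11)[OF v] R(12)[OF v] by (simp add: ex_sup_closed ex_con_sem)
    show "v \<notin> mset_fv CS (add_mset Skip \<Gamma>)" if v: "v \<in> \<rho> ` X - X" for v
      using R(12)[OF v] by simp
    show "mset_nf CS \<rho> (add_mset Skip \<Gamma>) = mset_nf CS id (mset (map fst (\<Gamma>\<^sub>1 @ \<Gamma>\<^sub>2)))"
      unfolding rest[symmetric] by simp
    show "X' \<union> B = \<rho> ` X \<union> (Y \<union> B)" using R(5) by blast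
  qed (use R(1,2,3,6,7) B(2,3) in auto)
  ultimately show ?case by blast
next
  case (sum c P bs d X \<Gamma>)
  note R = renaming_relD[OF sum.prems]
  have "add_mset (PSum (map (\<lambda>(c, P). (con_nf CS c \<rho>, proc_nf CS P \<rho>)) bs)) (mset_nf CS \<rho> \<Gamma>) =
      mset_nf CS id (mset (map fst \<Gamma>'))"
    using R(9) by simp
  then obtain \<Gamma>\<^sub>1 Q j \<Gamma>\<^sub>2 where \<Gamma>': "\<Gamma>' = \<Gamma>\<^sub>1 @ [(Q, j)] @ \<Gamma>\<^sub>2" and "\<forall>Q' R. Q \<noteq> Par Q' R"
    and "proc_nf CS Q id = {#PSum (map (\<lambda>(c, P). (con_nf CS c \<rho>, proc_nf CS P \<rho>)) bs)#}"
    and rest: "mset_nf CS \<rho> \<Gamma> = mset_nf CS id (mset (map fst (\<Gamma>\<^sub>1 @ \<Gamma>\<^sub>2)))"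
    using mset_nf_focus[OF _ assms(4)] by blast
  then obtain bs' where Q: "Q = Sum bs'"
    and bs': "map (\<lambda>(c, P). (con_nf CS c id, proc_nf CS P id)) bs' =
      map (\<lambda>(c, P). (con_nf CS c \<rho>, proc_nf CS P \<rho>)) bs"
    by (cases Q) auto
  have "(con_nf CS c \<rho>, proc_nf CS P \<rho>) \<in> set (map (\<lambda>(c, P). (con_nf CS c id, proc_nf CS P id)) bs')"
    unfolding bs' using sum.hyps(1) by force
  then obtain c' P' where in': "(c', P') \<in> set bs'" and c': "con_nf CS c' id = con_nf CS c \<rho>"
    and P': "proc_nf CS P' id = proc_nf CS P \<rho>"
    by auto
  \<comment> \<open>Renaming preserves the entailment of the guard, and the store before hiding
    \<open>Y\<close> is at least as strong.\<close>
  have "con_sem CS c' \<le> con_sem CS (con_subst CS \<rho> d)"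
    unfolding con_sem_renamed[OF c'] using sum.hyps(2) by (intro con_sem_subst_mono) (simp add: entails_def)
  also have "\<dots> \<le> store_sem CS S"
    unfolding R(10)[symmetric] by (rule ex_set_le) (rule R(2))
  finally have ent: "entails (store_sem CS S) (con_sem CS c')" by (simp add: entails_def)
  obtain j' where j': "j' \<notin> ids \<Gamma>'" using ex_fresh_id by blast
  have "coll_step CS D (X', \<Gamma>', S) (X', \<Gamma>\<^sub>1 @ [(P', j')] @ \<Gamma>\<^sub>2, S)"
    using j' unfolding \<Gamma>' Q by (intro coll_step.sum[OF in' ent])
  moreover have "renaming_rel CS \<rho> Y (X, add_mset P \<Gamma>, d) (X', \<Gamma>\<^sub>1 @ [(P', j')] @ \<Gamma>\<^sub>2, S)"
  proof (rule renaming_relI)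
    show "distinct (map snd (\<Gamma>\<^sub>1 @ [(P', j')] @ \<Gamma>\<^sub>2))" using R(4) j' unfolding \<Gamma>' by (auto simp: ids_def)
    have "proc_fv CS P' \<subseteq> proc_fv CS (Sum bs')" using in' by (auto intro!: bexI[of _ "(c', P')"])
    then show "Y \<inter> tagged_fv CS (\<Gamma>\<^sub>1 @ [(P', j')] @ \<Gamma>\<^sub>2) = {}"
      using R(8) unfolding \<Gamma>' Q append.simps tagged_fv_simps by blast
    show "mset_nf CS \<rho> (add_mset P \<Gamma>) = mset_nf CS id (mset (map fst (\<Gamma>\<^sub>1 @ [(P', j')] @ \<Gamma>\<^sub>2)))"
      using rest P' by simp
    have "proc_fv CS P \<subseteq> proc_fv CS (Sum bs)" using sum.hyps(1) by (auto intro!: bexI[of _ "(c, P)"])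
    then show "v \<notin> mset_fv CS (add_mset P \<Gamma>)" if v: "v \<in> \<rho> ` X - X" for v
      using R(12)[OF v] unfolding mset_fv_simps by blast
  qed (use R in auto)
  ultimately show ?case by blast
next
  case (local x X d \<Gamma> P)
  note R = renaming_relD[OF local.prems]
  have "add_mset (PLocal (\<lambda>y. proc_nf CS P (\<rho>(x := y)))) (mset_nf CS \<rho> \<Gamma>) =
      mset_nf CS id (mset (map fst \<Gamma>'))"
    using R(9) by simp
  then obtain \<Gamma>\<^sub>1 Q' j \<Gamma>\<^sub>2 where \<Gamma>': "\<Gamma>' = \<Gamma>\<^sub>1 @ [(Q', j)] @ \<Gamma>\<^sub>2" and "\<forall>Q R. Q' \<noteq> Par Q R"
    and "proc_nf CS Q' id = {#PLocal (\<lambda>y. proc_nf CS P (\<rho>(x := y)))#}"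
    and rest: "mset_nf CS \<rho> \<Gamma> = mset_nf CS id (mset (map fst (\<Gamma>\<^sub>1 @ \<Gamma>\<^sub>2)))"
    using mset_nf_focus[OF _ assms(4)] by blast
  then obtain z Q where Q': "Q' = Local z Q"
    and Q: "(\<lambda>y. proc_nf CS Q (id(z := y))) = (\<lambda>y. proc_nf CS P (\<rho>(x := y)))"
    by (cases Q') auto
  \<comment> \<open>The new name must be fresh on both sides: it enters the image of the renaming,
    and names there outside the standard hidden variables must be irrelevant to the standard store
    and processes.\<close>
  let ?F = "X \<union> X' \<union> store_fv CS S \<union> tagged_fv CS \<Gamma>' \<union> con_fv CS d \<union> mset_fv CS \<Gamma> \<union> proc_fv CS P \<union> {x}"
  have "finite ?F" using R(1-3,5) by simp
  then have "\<exists>x'. x' \<notin> ?F" by (rule ex_new_if_finite[OF infinite_UNIV])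
  then obtain x' where x': "x' \<notin> ?F" ..
  obtain j' where j': "j' \<notin> ids \<Gamma>'" using ex_fresh_id by blast
  let ?Q = "proc_subst CS (id(z := x')) Q" and ?\<rho> = "\<rho>(x := x')"
  have x: "x \<notin> X" "x \<notin> con_fv CS d" "x \<notin> mset_fv CS \<Gamma>" using local.hyps by auto
  have "x' \<notin> proc_fv CS (Local z Q)" using x' unfolding \<Gamma>' Q' by auto
  moreover have "x' \<notin> fvars CS X' S \<Gamma>\<^sub>1 \<Gamma>\<^sub>2" using x' unfolding \<Gamma>' fvars_def by auto
  ultimately have "coll_step CS D (X', \<Gamma>', S) (X' \<union> {x'}, \<Gamma>\<^sub>1 @ [(?Q, j')] @ \<Gamma>\<^sub>2, S)"
    using j' unfolding \<Gamma>' Q' by (intro coll_step.local)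
  moreover have "renaming_rel CS ?\<rho> Y (X \<union> {x}, add_mset P \<Gamma>, d)
      (X' \<union> {x'}, \<Gamma>\<^sub>1 @ [(?Q, j')] @ \<Gamma>\<^sub>2, S)"
  proof (rule renaming_relI)
    have img: "?\<rho> ` (X \<union> {x}) = insert x' (\<rho> ` X)" using x(1) by auto
    show "X' \<union> {x'} = ?\<rho> ` (X \<union> {x}) \<union> Y" unfolding img using R(5) by blast
    have "inj_on ?\<rho> X" using R(6) x(1) by (auto simp: inj_on_def)
    moreover have "x' \<notin> \<rho> ` X" using x' R(5) by blast
    ultimately show "inj_on ?\<rho> (X \<union> {x})" using x(1) by auto
    show "distinct (map snd (\<Gamma>\<^sub>1 @ [(?Q, j')] @ \<Gamma>\<^sub>2))" using R(4) j' unfolding \<Gamma>' by (auto simp: ids_def)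
    have "proc_fv CS ?Q \<subseteq> insert x' (proc_fv CS (Local z Q))" by (auto simp: proc_fv_subst)
    moreover have "x' \<notin> Y" using x' R(5) by blast
    ultimately show "Y \<inter> tagged_fv CS (\<Gamma>\<^sub>1 @ [(?Q, j')] @ \<Gamma>\<^sub>2) = {}"
      using R(8) unfolding \<Gamma>' Q' append.simps tagged_fv_simps by blast
    have "mset_nf CS ?\<rho> \<Gamma> = mset_nf CS \<rho> \<Gamma>"
      using x(3) by (intro mset_nf_subst_cong) auto
    \<comment> \<open>Evaluating both binder functions at \<open>x'\<close> identifies the two
      opened bodies.\<close>
    moreover have "proc_nf CS ?Q id = proc_nf CS P ?\<rho>"
      using fun_cong[OF Q, of x'] by (simp add: proc_nf_subst)
    ultimately show "mset_nf CS ?\<rho> (add_mset P \<Gamma>) = mset_nf CS id (mset (map fst (\<Gamma>\<^sub>1 @ [(?Q, j')] @ \<Gamma>\<^sub>2)))"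
      using rest by simp
    have "con_sem CS (con_subst CS ?\<rho> d) = con_sem CS (con_subst CS \<rho> d)"
      using x(2) by (intro con_sem_subst_cong) auto
    then show "ex_set CS Y (store_sem CS S) = con_sem CS (con_subst CS ?\<rho> d)" using R(10) by simp
    show "ex CS v (con_sem CS d) = con_sem CS d" if v: "v \<in> ?\<rho> ` (X \<union> {x}) - (X \<union> {x})" for v
    proof (cases "v = x'")
      case True
      then show ?thesis using x' by (simp add: ex_con_sem)
    next
      case False
      then show ?thesis using v R(11)[of v] unfolding img by blast
    qed
    show "v \<notin> mset_fv CS (add_mset P \<Gamma>)" if v: "v \<in> ?\<rho> ` (X \<union> {x}) - (X \<union> {x})" for v
    proof (cases "v = x'")
      case True
      then show ?thesis using x' by simp
    next
      case False
      then have "v \<in> \<rho> ` X - X" "v \<noteq> x" using v unfolding img by auto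
      then show ?thesis using R(12)[of v] by simp
    qed
    show "?\<rho> v = v" if "v \<notin> X \<union> {x}" for v using that R(7) by simp
  qed (use R(1-3) in auto)
  ultimately show ?case by blast
next
  case (call p ys P xs X \<Gamma> d)
  note R = renaming_relD[OF call.prems]
  have "add_mset (PCall p (map \<rho> xs)) (mset_nf CS \<rho> \<Gamma>) = mset_nf CS id (mset (map fst \<Gamma>'))"
    using R(9) by simp
  then obtain \<Gamma>\<^sub>1 Q j \<Gamma>\<^sub>2 where \<Gamma>': "\<Gamma>' = \<Gamma>\<^sub>1 @ [(Q, j)] @ \<Gamma>\<^sub>2" and "\<forall>Q' R. Q \<noteq> Par Q' R"
    and "proc_nf CS Q id = {#PCall p (map \<rho> xs)#}"
    and rest: "mset_nf CS \<rho> \<Gamma> = mset_nf CS id (mset (map fst (\<Gamma>\<^sub>1 @ \<Gamma>\<^sub>2)))"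
    using mset_nf_focus[OF _ assms(4)] by blast
  then have Q: "Q = Call p (map \<rho> xs)" by (cases Q) auto
  obtain j' where j': "j' \<notin> ids \<Gamma>'" using ex_fresh_id by blast
  have len: "length (map \<rho> xs) = length ys" using call.hyps(2) by simp
  let ?P = "proc_subst CS (param_subst ys xs) P" and ?Q = "proc_subst CS (param_subst ys (map \<rho> xs)) P"
  have "coll_step CS D (X', \<Gamma>', S) (X', \<Gamma>\<^sub>1 @ [(?Q, j')] @ \<Gamma>\<^sub>2, S)"
    using j' unfolding \<Gamma>' Q by (intro coll_step.call[OF call.hyps(1) len])
  moreover have "renaming_rel CS \<rho> Y (X, add_mset ?P \<Gamma>, d) (X', \<Gamma>\<^sub>1 @ [(?Q, j')] @ \<Gamma>\<^sub>2, S)"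
  proof (rule renaming_relI)
    show "distinct (map snd (\<Gamma>\<^sub>1 @ [(?Q, j')] @ \<Gamma>\<^sub>2))" using R(4) j' unfolding \<Gamma>' by (auto simp: ids_def)
    show "Y \<inter> tagged_fv CS (\<Gamma>\<^sub>1 @ [(?Q, j')] @ \<Gamma>\<^sub>2) = {}"
      using R(8) proc_fv_call[OF assms(2) call.hyps(1) len]
      unfolding \<Gamma>' Q append.simps tagged_fv_simps proc_fv.simps by blast
    \<comment> \<open>The environments need to agree on formal parameters only, where renaming the
      arguments commutes with parameter passing.\<close>
    have "proc_fv CS P \<subseteq> set ys" using assms(2) call.hyps(1) by (fastforce simp: wf_defs_def)
    then have "proc_nf CS ?Q id = proc_nf CS ?P \<rho>"
      unfolding proc_nf_subst
      by (intro proc_nf_cong) (use param_subst_map[OF _ call.hyps(2)] in auto)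
    then show "mset_nf CS \<rho> (add_mset ?P \<Gamma>) = mset_nf CS id (mset (map fst (\<Gamma>\<^sub>1 @ [(?Q, j')] @ \<Gamma>\<^sub>2)))"
      using rest by simp
    show "v \<notin> mset_fv CS (add_mset ?P \<Gamma>)" if v: "v \<in> \<rho> ` X - X" for v
      using R(12)[OF v] proc_fv_call[OF assms(2) call.hyps(1,2)]
      unfolding mset_fv_simps proc_fv.simps by blast
  qed (use R in auto)
  ultimately show ?case by blast
next
  case (equiv s1 s2 s2' s1')
  have "renaming_rel CS \<rho> Y s2 (X', \<Gamma>', S)"
    by (rule renaming_rel_std_cong[OF equiv.hyps(1) equiv.prems])
  then obtain k' \<rho>' Y' where "coll_step CS D (X', \<Gamma>', S) k'" "renaming_rel CS \<rho>' Y' s2' k'"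
    using equiv.IH by blast
  then show ?case using renaming_rel_std_cong[OF equiv.hyps(3)] by blast
qed

text \<open>The sequence is fully split first; the identification rule makes this part of the
  collecting step.\<close>

lemma std_step_coll:
  assumes "std_step CS D s s'" "wf_defs CS D" "renaming_rel CS \<rho> Y s k"
  shows "\<exists>k' \<rho>' Y'. coll_step CS D k k' \<and> renaming_rel CS \<rho>' Y' s' k'"
proof -
  obtain X' \<Gamma>' S where k: "k = (X', \<Gamma>', S)" by (cases k)
  obtain X \<Gamma> d where s: "s = (X, \<Gamma>, d)" by (cases s)
  have "distinct (map snd \<Gamma>')" using renaming_relD(4) assms(3) unfolding k s by blast
  then obtain \<Delta> where \<Delta>: "equivclp par_split \<Gamma>' \<Delta>" "distinct (map snd \<Delta>)" "no_par \<Delta>"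
    using par_split_exhaust by blast
  have "renaming_rel CS \<rho> Y s (X', \<Delta>, S)"
    by (rule renaming_rel_par_split[OF assms(3)[unfolded k] \<Delta>(1,2)])
  then obtain k' \<rho>' Y' where k': "coll_step CS D (X', \<Delta>, S) k'" "renaming_rel CS \<rho>' Y' s' k'"
    using std_step_coll_no_par[OF assms(1,2)] \<Delta>(3) by blast
  have "coll_ident k (X', \<Delta>, S)" unfolding k using \<Delta>(1) by simp
  moreover have "coll_ident k' k'" by (cases k') simp
  ultimately have "coll_step CS D k k'" using k'(1) by (blast intro: coll_step.ident)
  then show ?thesis using k'(2) by blast
qed

lemma std_steps_coll:
  assumes "(std_step CS D)\<^sup>*\<^sup>* s s'" "wf_defs CS D" "renaming_rel CS \<rho> Y s k"
  shows "\<exists>k' \<rho>' Y'. (coll_step CS D)\<^sup>*\<^sup>* k k' \<and> renaming_rel CS \<rho>' Y' s' k'"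
  using assms(1)
proof (induction rule: rtranclp_induct)
  case base
  show ?case using assms(3) by blast
next
  case (step s1 s2)
  then obtain k1 \<rho>1 Y1 where k1: "(coll_step CS D)\<^sup>*\<^sup>* k k1" "renaming_rel CS \<rho>1 Y1 s1 k1" by blast
  obtain k2 \<rho>2 Y2 where "coll_step CS D k1 k2" "renaming_rel CS \<rho>2 Y2 s2 k2"
    using std_step_coll[OF step.hyps(2) assms(2) k1(2)] by blast
  then show ?case using k1(1) by (blast intro: rtranclp.rtrancl_into_rtrancl)
qed

section \<open>Hidden variables under renaming\<close>

lemma con_sem_foldr_Exi: "con_sem CS (foldr Exi xs c) = ex_set CS (set xs) (con_sem CS c)"
  by (induction xs) simp_all

lemma con_fv_foldr_Exi: "con_fv CS (foldr Exi xs c) = con_fv CS c - set xs"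
  by (induction xs) auto

text \<open>Renaming a quantifier prefix together with its body is an alpha conversion if
  \<open>\<rho>\<close> is injective on the prefix and sends no other free variable into the new
  prefix. The environments vary because each quantifier updates one at \<open>x\<close> and the
  other at \<open>\<rho> x\<close>.\<close>

lemma con_nf_foldr_Exi_rename:
  assumes "distinct xs" "inj_on \<rho> (set xs)"
    and "\<And>v. v \<in> con_fv CS c - set xs \<Longrightarrow> \<tau> (\<rho> v) = \<sigma> v \<and> \<rho> v \<notin> \<rho> ` set xs"
  shows "con_nf CS (foldr Exi (map \<rho> xs) (con_subst CS \<rho> c)) \<tau> = con_nf CS (foldr Exi xs c) \<sigma>"
  using assms
proof (induction xs arbitrary: \<sigma> \<tau>)
  case Nil
  have "con_nf CS c (\<tau> \<circ> \<rho>) = con_nf CS c \<sigma>"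
    by (rule con_nf_cong) (use Nil.prems(3) in auto)
  then show ?case by (simp add: con_nf_subst)
next
  case (Cons x xs)
  have "con_nf CS (foldr Exi (map \<rho> xs) (con_subst CS \<rho> c)) (\<tau>(\<rho> x := y)) =
      con_nf CS (foldr Exi xs c) (\<sigma>(x := y))" for y
  proof (rule Cons.IH)
    fix v assume v: "v \<in> con_fv CS c - set xs"
    show "(\<tau>(\<rho> x := y)) (\<rho> v) = (\<sigma>(x := y)) v \<and> \<rho> v \<notin> \<rho> ` set xs"
    proof (cases "v = x")
      case True
      then show ?thesis using Cons.prems(1,2) by auto
    next
      case False
      then show ?thesis using v Cons.prems(3)[of v] by auto
    qed
  qed (use Cons.prems(1,2) in auto)
  then show ?case by simp
qed

text \<open>Variables of the store that clash with the new names are irrelevant to it by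
  assumption, so they may be quantified away before renaming.\<close>

lemma renaming_rel_hidden:
  assumes "renaming_rel CS \<rho> Y (X, \<Gamma>, d) (X', \<Gamma>', S)"
  shows "ex_set CS X' (store_sem CS S) = ex_set CS X (con_sem CS d)"
proof -
  note R = renaming_relD[OF assms]
  obtain xs where xs: "set xs = X" "distinct xs" using R(1) finite_distinct_list by blast
  obtain ws where ws: "set ws = \<rho> ` X - X" using R(1) finite_list[of "\<rho> ` X - X"] by auto
  define e where "e = foldr Exi ws d"
  have sem: "con_sem CS e = con_sem CS d"
    unfolding e_def con_sem_foldr_Exi using R(1,11) ws by (intro ex_set_closed) auto
  have "con_nf CS (foldr Exi (map \<rho> xs) (con_subst CS \<rho> e)) id = con_nf CS (foldr Exi xs e) id"
    \<comment> \<open>A free variable of \<open>e\<close> outside \<open>X\<close> is fixed by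
      \<open>\<rho>\<close>; as \<open>ws\<close> is quantified in \<open>e\<close>, it does not lie
      in the image of \<open>X\<close>.\<close>
    by (rule con_nf_foldr_Exi_rename) (use xs ws R(6,7) in \<open>auto simp: e_def con_fv_foldr_Exi\<close>)
  then have "con_sem CS (foldr Exi (map \<rho> xs) (con_subst CS \<rho> e)) = con_sem CS (foldr Exi xs e)"
    by (rule con_sem_eq_if_nf_eq)
  then have "ex_set CS (\<rho> ` X) (con_sem CS (con_subst CS \<rho> e)) = ex_set CS X (con_sem CS d)"
    unfolding con_sem_foldr_Exi set_map xs(1) sem .
  moreover have "con_sem CS (con_subst CS \<rho> e) = con_sem CS (con_subst CS \<rho> d)"
    using sem by (intro order_antisym con_sem_subst_mono) simp_all
  moreover have "ex_set CS X' (store_sem CS S) = ex_set CS (\<rho> ` X) (ex_set CS Y (store_sem CS S))"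
    unfolding R(5) using R(1,2) by (intro ex_set_union) auto
  ultimately show ?thesis using R(10) by simp
qed

end

section \<open>Runs as finite sequences, and the equivalence of the two semantics\<close>

lemma rtranclp_iff_run:
  "r\<^sup>*\<^sup>* a b \<longleftrightarrow> (\<exists>(n::nat) f. f 0 = a \<and> f n = b \<and> (\<forall>k<n. r (f k) (f (Suc k))))"
  unfolding rtranclp_power relpowp_fun_conv by blast

theorem theorem1:
  fixes CS :: "('v::{countable,infinite}, 'a, 'c::complete_lattice) csystem"
    and D :: "('p \<times> 'v list \<times> ('v, 'a, 'p) proc) set"
    and P :: "('v, 'a, 'p) proc"
    and c :: 'c
    and i :: nat
  assumes "constraint_language CS"
    and "wf_defs CS D"
    and "wf_proc P"
  shows "(\<exists>X' \<Gamma>' d'. (std_step CS D)\<^sup>*\<^sup>* ({}, {#P#}, TT) (X', \<Gamma>', d') \<and>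
            entails (ex_set CS X' (con_sem CS d')) c)
     \<longleftrightarrow> (\<exists>(n::nat) X \<Gamma> S. (X 0, \<Gamma> 0, S 0) = ({}, [(P, i)], {}) \<and>
            (\<forall>k<n. coll_step CS D (X k, \<Gamma> k, S k) (X (Suc k), \<Gamma> (Suc k), S (Suc k))) \<and>
            entails (ex_set CS (X n) (store_sem CS (S n))) c)"
    (is "?std \<longleftrightarrow> ?coll")
proof
  interpret constraint_language CS by (rule assms(1))
  assume ?std
  then obtain X' \<Gamma>' d' where std: "(std_step CS D)\<^sup>*\<^sup>* ({}, {#P#}, TT) (X', \<Gamma>', d')"
    and c: "entails (ex_set CS X' (con_sem CS d')) c" by blast
  \<comment> \<open>Nothing is hidden at the start, and the join of the empty store is
    \<open>bot\<close>, the meaning of \<open>TT\<close>.\<close>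
  have "renaming_rel CS id {} ({}, {#P#}, TT) ({}, [(P, i)], {})"
    by (rule renaming_relI) (auto simp: store_sem_def)
  then obtain k \<rho> Y where k: "(coll_step CS D)\<^sup>*\<^sup>* ({}, [(P, i)], {}) k"
      "renaming_rel CS \<rho> Y (X', \<Gamma>', d') k"
    using std_steps_coll[OF std assms(2)] by blast
  then obtain n f where f: "f 0 = ({}, [(P, i)], {})" "f n = k"
      "\<And>m. m < n \<Longrightarrow> coll_step CS D (f m) (f (Suc m))"
    unfolding rtranclp_iff_run by blast
  have "entails (ex_set CS (fst (f n)) (store_sem CS (snd (snd (f n))))) c"
    using renaming_rel_hidden[of \<rho> Y X' \<Gamma>' d'] k(2) c f(2) by (cases k) simp
  then show ?coll
    using f by (intro exI[of _ n] exI[of _ "\<lambda>m. fst (f m)"] exI[of _ "\<lambda>m. fst (snd (f m))"]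
        exI[of _ "\<lambda>m. snd (snd (f m))"]) simp
next
  interpret constraint_language CS by (rule assms(1))
  assume ?coll
  then obtain n X \<Gamma> S where init: "(X 0, \<Gamma> 0, S 0) = ({}, [(P, i)], {})"
    and steps: "\<forall>k<n. coll_step CS D (X k, \<Gamma> k, S k) (X (Suc k), \<Gamma> (Suc k), S (Suc k))"
    and c: "entails (ex_set CS (X n) (store_sem CS (S n))) c" by blast
  have "(coll_step CS D)\<^sup>*\<^sup>* ({}, [(P, i)], {}) (X n, \<Gamma> n, S n)"
    unfolding rtranclp_iff_run
    using init steps by (intro exI[of _ n] exI[of _ "\<lambda>m. (X m, \<Gamma> m, S m)"]) auto
  moreover have "coll_std_rel CS ({}, [(P, i)], {}) ({}, {#P#}, TT)"
    by (simp add: store_sem_def)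
  ultimately obtain s where s: "(std_step CS D)\<^sup>*\<^sup>* ({}, {#P#}, TT) s" "coll_std_rel CS (X n, \<Gamma> n, S n) s"
    using coll_steps_std[OF _ assms(2)] by blast
  obtain X' \<Gamma>' d' where s_eq: "s = (X', \<Gamma>', d')" by (cases s)
  then obtain Y where "finite X'" "finite Y" "X n = X' \<union> Y" "con_sem CS d' = ex_set CS Y (store_sem CS (S n))"
    using s(2) by auto
  \<comment> \<open>Hiding \<open>Y\<close> first yields the standard store, and hiding
    \<open>X'\<close> then gives the same observable constraint.\<close>
  then have "ex_set CS (X n) (store_sem CS (S n)) = ex_set CS X' (con_sem CS d')"
    by (simp add: ex_set_union)
  then show ?std using s(1) c unfolding s_eq by auto
qed

end
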